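(* There is a constant $K>0$ depending only on the underlying norm in the space $\mathbb{R}^d$ such that the following holds. Let $F\in\mathcal{F}[-\pi,\pi]$ and $x\in(-\pi,\pi)$. Then there exists $\delta_0=\delta_0(x)>0$ such that for all $\delta\in(0,\delta_0]$ and all $n\in\mathbb{N}$ $$\mathrm{haus}\big(\mathscr{S}_nF(x),A_F(x)\big)\le K\left[\frac{V_{-\pi}^{\pi}(F)}{n}\left(1+6\cot\left(\frac{\delta}{2}\right)\right)+\omega(\delta)\right],$$ where $\omega(\delta)=\max\big\{\varpi^-(v_F,x,2\delta),\ \varpi^+(v_F,x,\delta)\big\}$, $\mathscr{S}_nF$ is the $n$-th term of the metric Fourier series of $F$, and $A_F(x)=\left\{\tfrac12\big(s(x+0)+s(x-0)\big)\ :\ s\in\mathcal{S}(F)\right\}$.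
   Context: Fix $d\ge1$ and a norm $|\cdot|$ on $\mathbb{R}^d$. $\mathrm{K}(\mathbb{R}^d)$ is the collection of non-empty compact subsets of $\mathbb{R}^d$. For non-empty $A,B\subset\mathbb{R}^d$, $\mathrm{haus}(A,B)=\max\{\sup_{a\in A}\mathrm{dist}(a,B),\sup_{b\in B}\mathrm{dist}(b,A)\}$ with $\mathrm{dist}(c,D)=\inf_{d\in D}|c-d|$. The total variation of $F:[a,b]\to\mathrm{K}(\mathbb{R}^d)$ is $V_a^b(F)=\sup\sum_{i=1}^n\mathrm{haus}(F(x_i),F(x_{i-1}))$ over all partitions $a=x_0<\dots<x_n=b$. $\mathcal{F}[a,b]$ is the set of all $F:[a,b]\to\mathrm{K}(\mathbb{R}^d)$ with $V_a^b(F)<\infty$ whose graph $\{(x,y): x\in[a,b],\ y\in F(x)\}$ is compact. The variation function of $F$ is $v_F(x)=V_a^x(F)$, $x\in[a,b]$ (here $[a,b]=[-\pi,\pi]$). For a function $f:[a,b]\to\mathbb{R}$ of bounded variation and $\delta>0$, the left local quasi-modulus at $x^*\in(a,b]$ is $\varpi^-(f,x^*,\delta)=\sup\{|f(x^*-0)-f(x)|:\ x\in[x^*-\delta,x^* )\cap[a,b]\}$ and the right local quasi-modulus at $x^*\in[a,b)$ is $\varpi^+(f,x^*,\delta)=\sup\{|f(x^*+0)-f(x)|:\ x\in(x^*,x^*+\delta]\cap[a,b]\}$, where $f(x^*\mp0)$ are the one-sided limits. For $A,B\in\mathrm{K}(\mathbb{R}^d)$, the set of metric pairs is $\Pi(A,B)=\{(a,b)\in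 A\times B:\ |a-b|=\mathrm{dist}(b,A)\ \text{or}\ |a-b|=\mathrm{dist}(a,B)\}$. A metric chain of $A_0,\dots,A_n$ is a tuple $(a_0,\dots,a_n)$ with $(a_i,a_{i+1})\in\Pi(A_i,A_{i+1})$, $i=0,\dots,n-1$; $\mathrm{CH}(A_0,\dots,A_n)$ is the set of all metric chains. Given a partition $\chi=\{a=x_0<\dots<x_n=b\}$ with norm $|\chi|=\max_i(x_{i+1}-x_i)$ and a metric chain $\phi=(y_0,\dots,y_n)\in\mathrm{CH}(F(x_0),\dots,F(x_n))$, the chain function $c_{\chi,\phi}:[a,b]\to\mathbb{R}^d$ is $c_{\chi,\phi}(x)=y_i$ for $x\in[x_i,x_{i+1})$, $0\le i\le n-1$, and $c_{\chi,\phi}(x_n)=y_n$. A selection $s$ of $F$ (i.e. $s:[a,b]\to\mathbb{R}^d$, $s(x)\in F(x)$ for all $x$) is a metric selection if there are chain functions $c_{\chi_k,\phi_k}$ of $F$ with $|\chi_k|\to0$ and $s(x)=\lim_{k\to\infty}c_{\chi_k,\phi_k}(x)$ for every $x\in[a,b]$. $\mathcal{S}(F)$ is the set of metric selections of $F$. It is known that every metric selection of $F\in\mathcal{F}[a,b]$ has bounded variation, so the one-sided limits $s(x\pm0)$ exist. For $k:[a,b]\to\mathbb{R}$ and a partition $\chi$, the weighted metric Riemann sum is $(\mathcal{M}_k)S_\chi F=\{\sum_{i=0}^{n-1}(x_{i+1}-x_i)k(x_i)y_i:\ (y_0,\dots,y_{n-1})\in\mathrm{CH}(F(x_0),\dots,F(x_{n-1}))\}$.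 The weighted metric integral $(\mathcal{M}_k)\int_a^bk(x)F(x)dx$ is the set of all $y\in\mathbb{R}^d$ for which there are partitions $\chi_n$ with $|\chi_n|\to0$ and points $y_n\in(\mathcal{M}_k)S_{\chi_n}F$ with $y_n\to y$. The Dirichlet kernel is $D_n(x)=\frac12+\sum_{k=1}^n\cos kx$, and $\partial_{n,x}(t)=D_n(x-t)$. The metric Fourier series of $F:[-\pi,\pi]\to\mathrm{K}(\mathbb{R}^d)$ is the sequence of set-valued functions $\mathscr{S}_nF(x)=\frac1\pi(\mathcal{M}_{\partial_{n,x}})\int_{-\pi}^{\pi}\partial_{n,x}(t)F(t)dt$, $x\in[-\pi,\pi]$, $n\in\mathbb{N}$. *)

theory Defs
  imports "HOL-Analysis.Analysis"
begin

text \<open>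
  The ambient space is \<open>real ^ 'd\<close> with an arbitrary norm \<open>N\<close>, passed as an explicit argument
  because the class constant \<^const>\<open>norm\<close> is the Euclidean norm. \<open>N\<close> enters only through distances;
  compactness and limits refer to the standard topology of \<open>real ^ 'd\<close>, which every norm induces.
  Functions on an interval \<open>[a, b]\<close> are total functions whose values outside the interval are
  irrelevant.
\<close>

definition is_norm :: "('a::real_vector \<Rightarrow> real) \<Rightarrow> bool" where
  "is_norm N \<longleftrightarrow>
     (\<forall>x. 0 \<le> N x) \<and>
     (\<forall>x. N x = 0 \<longleftrightarrow> x = 0) \<and>
     (\<forall>c x. N (c *\<^sub>R x) = \<bar>c\<bar> * N x) \<and>
     (\<forall>x y. N (x + y) \<le> N x + N y)"

text \<open>
  Distances are taken in \<^typ>\<open>ennreal\<close>, so that suprema and infima exist for arbitrary sets. In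
  particular a finite bound on \<open>haus N A B\<close> means what it says even if boundedness of \<open>A\<close>, \<open>B\<close>
  is not known beforehand, and \<open>haus N A B = \<infinity>\<close> if exactly one of the two sets is empty.
\<close>

definition pt_dist :: "('a::real_vector \<Rightarrow> real) \<Rightarrow> 'a \<Rightarrow> 'a set \<Rightarrow> ennreal" where
  "pt_dist N c D = (INF d\<in>D. ennreal (N (c - d)))"

definition haus :: "('a::real_vector \<Rightarrow> real) \<Rightarrow> 'a set \<Rightarrow> 'a set \<Rightarrow> ennreal" where
  "haus N A B = max (SUP a\<in>A. pt_dist N a B) (SUP b\<in>B. pt_dist N b A)"

text \<open>A partition \<open>a = \<xi> 0 < \<dots> < \<xi> n = b\<close>; only the values \<open>\<xi> 0, \<dots>, \<xi> n\<close> matter.\<close>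

definition is_partition :: "real \<Rightarrow> real \<Rightarrow> nat \<Rightarrow> (nat \<Rightarrow> real) \<Rightarrow> bool" where
  "is_partition a b n \<xi> \<longleftrightarrow> \<xi> 0 = a \<and> \<xi> n = b \<and> (\<forall>i<n. \<xi> i < \<xi> (Suc i))"

definition mesh :: "nat \<Rightarrow> (nat \<Rightarrow> real) \<Rightarrow> real" where
  "mesh n \<xi> = Max ((\<lambda>i. \<xi> (Suc i) - \<xi> i) ` {..<n})"

text \<open>For \<open>a = b\<close> the only partition has \<open>n = 0\<close>, whence the variation is \<open>0\<close>.\<close>

definition variation ::
    "('a::real_vector \<Rightarrow> real) \<Rightarrow> real \<Rightarrow> real \<Rightarrow> (real \<Rightarrow> 'a set) \<Rightarrow> ennreal" where
  "variation N a b F =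
     (SUP (n, \<xi>)\<in>{(n, \<xi>). is_partition a b n \<xi>}. \<Sum>i<n. haus N (F (\<xi> (Suc i))) (F (\<xi> i)))"

definition BV_compact_graph ::
    "(real ^ 'd \<Rightarrow> real) \<Rightarrow> real \<Rightarrow> real \<Rightarrow> (real \<Rightarrow> (real ^ 'd) set) set" where
  "BV_compact_graph N a b =
     {F. (\<forall>x\<in>{a..b}. F x \<noteq> {} \<and> compact (F x)) \<and>
         variation N a b F < \<infinity> \<and>
         compact {(x, y). x \<in> {a..b} \<and> y \<in> F x}}"

text \<open>The variation function \<open>v\<^sub>F\<close>, real-valued since it is used for \<open>F\<close> of bounded variation.\<close>

definition variation_fun ::
    "('a::real_vector \<Rightarrow> real) \<Rightarrow> real \<Rightarrow> (real \<Rightarrow> 'a set) \<Rightarrow> real \<Rightarrow> real" where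
  "variation_fun N a F x = enn2real (variation N a x F)"

definition left_quasi_modulus ::
    "real \<Rightarrow> real \<Rightarrow> (real \<Rightarrow> real) \<Rightarrow> real \<Rightarrow> real \<Rightarrow> real" where
  "left_quasi_modulus a b f x \<delta> =
     (SUP t\<in>{x - \<delta>..<x} \<inter> {a..b}. \<bar>Lim (at_left x) f - f t\<bar>)"

definition right_quasi_modulus ::
    "real \<Rightarrow> real \<Rightarrow> (real \<Rightarrow> real) \<Rightarrow> real \<Rightarrow> real \<Rightarrow> real" where
  "right_quasi_modulus a b f x \<delta> =
     (SUP t\<in>{x<..x + \<delta>} \<inter> {a..b}. \<bar>Lim (at_right x) f - f t\<bar>)"

definition metric_pairs ::
    "('a::real_vector \<Rightarrow> real) \<Rightarrow> 'a set \<Rightarrow> 'a set \<Rightarrow> ('a \<times> 'a) set" where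
  "metric_pairs N A B =
     {(a, b). a \<in> A \<and> b \<in> B \<and>
        (ennreal (N (a - b)) = pt_dist N b A \<or> ennreal (N (a - b)) = pt_dist N a B)}"

text \<open>
  Metric chains of \<open>A 0, \<dots>, A m\<close>; only \<open>y 0, \<dots>, y m\<close> matter. Membership \<open>y i \<in> A i\<close> is
  required separately because of the case \<open>m = 0\<close>.
\<close>

definition metric_chains ::
    "('a::real_vector \<Rightarrow> real) \<Rightarrow> nat \<Rightarrow> (nat \<Rightarrow> 'a set) \<Rightarrow> (nat \<Rightarrow> 'a) set" where
  "metric_chains N m A =
     {y. (\<forall>i\<le>m. y i \<in> A i) \<and> (\<forall>i<m. (y i, y (Suc i)) \<in> metric_pairs N (A i) (A (Suc i)))}"

definition chain_fun :: "nat \<Rightarrow> (nat \<Rightarrow> real) \<Rightarrow> (nat \<Rightarrow> 'a) \<Rightarrow> real \<Rightarrow> 'a" where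
  "chain_fun n \<xi> y x =
     (if x = \<xi> n then y n else y (THE i. i < n \<and> x \<in> {\<xi> i..<\<xi> (Suc i)}))"

definition metric_selections ::
    "(real ^ 'd \<Rightarrow> real) \<Rightarrow> real \<Rightarrow> real \<Rightarrow> (real \<Rightarrow> (real ^ 'd) set) \<Rightarrow> (real \<Rightarrow> real ^ 'd) set"
where
  "metric_selections N a b F =
     {s. (\<forall>x\<in>{a..b}. s x \<in> F x) \<and>
         (\<exists>n \<xi> \<phi>.
            (\<forall>k. is_partition a b (n k) (\<xi> k) \<and>
                 \<phi> k \<in> metric_chains N (n k) (\<lambda>i. F (\<xi> k i))) \<and>
            (\<lambda>k. mesh (n k) (\<xi> k)) \<longlonglongrightarrow> 0 \<and>
            (\<forall>x\<in>{a..b}. (\<lambda>k. chain_fun (n k) (\<xi> k) (\<phi> k) x) \<longlonglongrightarrow> s x))}"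

definition metric_riemann_sums ::
    "(real ^ 'd \<Rightarrow> real) \<Rightarrow> (real \<Rightarrow> real) \<Rightarrow> nat \<Rightarrow> (nat \<Rightarrow> real) \<Rightarrow>
      (real \<Rightarrow> (real ^ 'd) set) \<Rightarrow> (real ^ 'd) set" where
  "metric_riemann_sums N \<kappa> n \<xi> F =
     {\<Sum>i<n. ((\<xi> (Suc i) - \<xi> i) * \<kappa> (\<xi> i)) *\<^sub>R y i | y.
        y \<in> metric_chains N (n - 1) (\<lambda>i. F (\<xi> i))}"

definition weighted_metric_integral ::
    "(real ^ 'd \<Rightarrow> real) \<Rightarrow> (real \<Rightarrow> real) \<Rightarrow> real \<Rightarrow> real \<Rightarrow>
      (real \<Rightarrow> (real ^ 'd) set) \<Rightarrow> (real ^ 'd) set" where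
  "weighted_metric_integral N \<kappa> a b F =
     {y. \<exists>n \<xi> z.
        (\<forall>k. is_partition a b (n k) (\<xi> k) \<and>
             z k \<in> metric_riemann_sums N \<kappa> (n k) (\<xi> k) F) \<and>
        (\<lambda>k. mesh (n k) (\<xi> k)) \<longlonglongrightarrow> 0 \<and>
        z \<longlonglongrightarrow> y}"

definition dirichlet_kernel :: "nat \<Rightarrow> real \<Rightarrow> real" where
  "dirichlet_kernel n x = 1 / 2 + (\<Sum>k=1..n. cos (real k * x))"

definition metric_fourier ::
    "(real ^ 'd \<Rightarrow> real) \<Rightarrow> nat \<Rightarrow> (real \<Rightarrow> (real ^ 'd) set) \<Rightarrow> real \<Rightarrow> (real ^ 'd) set" where
  "metric_fourier N n F x =
     (\<lambda>y. (1 / pi) *\<^sub>R y) `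
       weighted_metric_integral N (\<lambda>t. dirichlet_kernel n (x - t)) (- pi) pi F"

definition limit_set ::
    "(real ^ 'd \<Rightarrow> real) \<Rightarrow> (real \<Rightarrow> (real ^ 'd) set) \<Rightarrow> real \<Rightarrow> (real ^ 'd) set" where
  "limit_set N F x =
     {(1 / 2) *\<^sub>R (Lim (at_right x) s + Lim (at_left x) s) | s.
        s \<in> metric_selections N (- pi) pi F}"

end

theory Submission imports Defs "HOL-Complex_Analysis.Great_Picard" begin

text \<open>
  By Helly's selection principle, the metric integral of \<open>\<kappa> F\<close> is the set of the integrals of \<open>\<kappa> s\<close>
  over all metric selections \<open>s\<close>, so that it suffices to estimate a single selection. Chain functions
  move at most as much as \<open>v\<^sub>F\<close> does between partition points; in the limit
  \<open>\<bar>s t - s u\<bar> \<le> v\<^sub>F u - v\<^sub>F (t - 0)\<close> for \<open>t \<le> u\<close>. The left limit at \<open>t\<close> is responsible for \<open>2 \<delta>\<close> in the left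
  quasi-modulus. Each component of \<open>s\<close> is therefore a difference of two monotone functions, and the
  second mean value theorem reduces the claim to bounds for the integrals of the Dirichlet kernel:
  uniformly bounded near \<open>x\<close>, and of order \<open>(1 + 2 cot (\<delta> / 2)) / n\<close> at distance at least \<open>\<delta>\<close> from \<open>x\<close>.
\<close>

section \<open>Integrals of the Dirichlet kernel\<close>

text \<open>The obstacle is that the integral of the absolute value of the Dirichlet kernel grows
  like log n. Absolute values therefore cannot be moved inside the integral: only signed integrals
  of the kernel, that is differences of its primitive, are bounded uniformly in n. The second mean
  value theorem exposes exactly these signed integrals, at the price of monotone factors. A second
  difficulty is that for \<open>x\<close> different from 0 the kernel has unequal mass on the two
  sides of \<open>x\<close>. The mean of the one-sided limits then appears only up to a defect,
  namely the jump of the selection at \<open>x\<close> times the deviation of one mass from pi / 2;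
  this deviation is again a difference of primitives at distance at least \<delta> from the
  singularity. All constants must be the same for all selections, since the two sets are compared by
  pairing the points that come from one selection. Hence one monotone control, built from the
  variation function alone, serves every selection and every component.\<close>

definition dirichlet_primitive :: "nat \<Rightarrow> real \<Rightarrow> real" where
  "dirichlet_primitive n u = u / 2 + (\<Sum>k=1..n. sin (real k * u) / real k)"

lemma dirichlet_primitive_deriv:
  "(dirichlet_primitive n has_real_derivative dirichlet_kernel n u) (at u)"
  unfolding dirichlet_primitive_def[abs_def] dirichlet_kernel_def
  by (auto intro!: derivative_eq_intros sum.cong)

lemma dirichlet_primitive_0 [simp]: "dirichlet_primitive n 0 = 0"
  by (simp add: dirichlet_primitive_def)

lemma dirichlet_primitive_minus [simp]: "dirichlet_primitive n (- u) = - dirichlet_primitive n u"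
  by (simp add: dirichlet_primitive_def sum_negf)

lemma dirichlet_primitive_pi [simp]: "dirichlet_primitive n pi = pi / 2"
  by (simp add: dirichlet_primitive_def)

text \<open>The sine terms are odd and 2 pi periodic, so only the linear term contributes the
  constant. This lets the kernel masses on both sides of \<open>x\<close> be expressed by the single
  number \<open>dirichlet_primitive n (x + pi)\<close>.\<close>

lemma dirichlet_primitive_reflect:
  "dirichlet_primitive n (2 * pi - u) = pi - dirichlet_primitive n u"
proof -
  have "sin (real k * (2 * pi - u)) = - sin (real k * u)" for k
  proof -
    have "sin (real k * (2 * pi - u)) = sin (- (real k * u) + of_nat k * (2 * pi))"
      by (simp add: algebra_simps)
    also have "\<dots> = sin (- (real k * u))"
      using sin.plus_of_nat[of "- (real k * u)" k] unfolding of_real_eq_id id_def .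
    finally show ?thesis by simp
  qed
  then show ?thesis
    by (simp add: dirichlet_primitive_def sum_negf diff_divide_distrib)
qed

lemma dirichlet_kernel_has_integral:
  assumes "c \<le> d"
  shows "((\<lambda>t. dirichlet_kernel n (x - t)) has_integral
           dirichlet_primitive n (x - c) - dirichlet_primitive n (x - d)) {c..d}"
proof -
  have "((\<lambda>t. - dirichlet_primitive n (x - t)) has_real_derivative dirichlet_kernel n (x - t))
        (at t within {c..d})" for t
    by (rule DERIV_subset[OF _ subset_UNIV])
       (auto intro!: derivative_eq_intros DERIV_chain'[OF _ dirichlet_primitive_deriv])
  then have "((\<lambda>t. dirichlet_kernel n (x - t)) has_integral
           - dirichlet_primitive n (x - d) - - dirichlet_primitive n (x - c)) {c..d}"
    using assms
    by (intro fundamental_theorem_of_calculus)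
       (simp_all add: has_real_derivative_iff_has_vector_derivative)
  then show ?thesis by simp
qed

text \<open>The right-hand side is sin((n + 1/2) u), left expanded: division by 2 sin(u/2) then
  splits the kernel into cos(nu)/2 and cot(u/2) sin(nu)/2, the latter a monotone factor times an
  oscillating one.\<close>

lemma dirichlet_kernel_closed_form:
  "2 * sin (u / 2) * dirichlet_kernel n u = sin (real n * u) * cos (u / 2) + cos (real n * u) * sin (u / 2)"
proof (induction n)
  case 0
  show ?case by (simp add: dirichlet_kernel_def)
next
  case (Suc n)
  have "sin (u/2) ^ 2 + cos (u/2) ^ 2 = 1" by simp
  moreover have "sin u = 2 * sin (u/2) * cos (u/2)" "cos u = cos (u/2)^2 - sin (u/2)^2"
    using sin_double[of "u/2"] cos_double[of "u/2"] by simp_all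
  moreover have "sin (real (Suc n) * u) = sin (real n * u) * cos u + cos (real n * u) * sin u"
    "cos (real (Suc n) * u) = cos (real n * u) * cos u - sin (real n * u) * sin u"
    by (simp_all add: distrib_right sin_add cos_add)
  moreover have "dirichlet_kernel (Suc n) u = dirichlet_kernel n u + cos (real (Suc n) * u)"
    by (simp add: dirichlet_kernel_def)
  ultimately show ?case
    using Suc.IH by algebra
qed

lemma cot_antimono:
  assumes "0 < u" "u \<le> v" "v < pi"
  shows "cot v \<le> cot u"
proof (rule DERIV_nonpos_imp_nonincreasing[OF assms(2)])
  fix y assume "u \<le> y" "y \<le> v"
  with assms have "sin y > 0" by (intro sin_gt_zero) auto
  then show "\<exists>z. DERIV cot y :> z \<and> z \<le> 0"
    by (intro exI[of _ "- inverse ((sin y)\<^sup>2)"]) (auto intro!: DERIV_cot)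
qed

text \<open>This is y cos y \<le> sin y, where the difference of the two sides has derivative y sin
  y. At y = 1/(2n) it cancels the factor n in the denominator of the increment bound.\<close>

lemma cot_le_inverse:
  assumes "0 < y" "y < pi / 2"
  shows "cot y \<le> 1 / y"
proof -
  have "sin 0 - 0 * cos 0 \<le> sin y - y * cos y"
  proof (rule DERIV_nonneg_imp_nondecreasing[where f = "\<lambda>y. sin y - y * cos y"])
    fix z assume "0 \<le> z" "z \<le> y"
    with assms have "0 \<le> z * sin z" by (intro mult_nonneg_nonneg sin_ge_zero) auto
    then show "\<exists>d. ((\<lambda>y. sin y - y * cos y) has_real_derivative d) (at z) \<and> 0 \<le> d"
      by (intro exI[of _ "z * sin z"]) (auto intro!: derivative_eq_intros)
  qed (use assms in auto)
  moreover have "sin y > 0" using assms by (intro sin_gt_zero) auto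
  ultimately show ?thesis
    using assms by (simp add: cot_def field_simps)
qed

text \<open>On the interval from \<delta> to 2 pi - \<delta> the decreasing function cot(u/2) is at
  most cot(\<delta>/2) in absolute value. The second mean value theorem takes it out of the integral
  and leaves integrals of sin(nu), each at most 2/n. The range has to exceed pi because x - t does
  so when \<open>x\<close> is positive.\<close>

lemma dirichlet_primitive_increment_bound:
  assumes "0 < \<delta>" "\<delta> \<le> c" "c \<le> d" "d \<le> 2 * pi - \<delta>" "n \<ge> 1"
  shows "\<bar>dirichlet_primitive n d - dirichlet_primitive n c\<bar> \<le> (1 + 2 * cot (\<delta> / 2)) / real n"
proof -
  define S where "S = (\<lambda>u. - cos (real n * u) / real n)"
  have n: "real n > 0" using assms by simp
  have int_sin: "((\<lambda>u. sin (real n * u)) has_integral S q - S p) {p..q}" if "p \<le> q" for p q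
    using that n unfolding S_def
    by (intro fundamental_theorem_of_calculus)
       (auto simp flip: has_real_derivative_iff_has_vector_derivative intro!: derivative_eq_intros)
  have S_bound: "\<bar>S q - S p\<bar> \<le> 2 / real n" for p q
  proof -
    have "\<bar>cos (real n * p) - cos (real n * q)\<bar> \<le> 2"
      using abs_cos_le_one[of "real n * p"] abs_cos_le_one[of "real n * q"] by linarith
    moreover have "S q - S p = (cos (real n * p) - cos (real n * q)) / real n"
      by (simp add: S_def diff_divide_distrib)
    ultimately show ?thesis
      using n by (simp add: divide_right_mono)
  qed
  \<comment> \<open>The sign makes the factor nondecreasing, as the second mean value theorem
    demands.\<close>
  have mono: "- cot (u / 2) \<le> - cot (v / 2)" if "c \<le> u" "u \<le> v" "v \<le> d" for u v
    using cot_antimono[of "u/2" "v/2"] that assms by simp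
  obtain e where e: "e \<in> {c..d}" and
    I: "((\<lambda>u. - cot (u / 2) * sin (real n * u)) has_integral
      (- cot (c / 2) * integral {c..e} (\<lambda>u. sin (real n * u)) + - cot (d / 2) * integral {e..d} (\<lambda>u. sin (real n * u)))) {c..d}"
    using second_mean_value_theorem_full[of "\<lambda>u. sin (real n * u)" c d "\<lambda>u. - cot (u / 2)"]
      mono int_sin[OF assms(3)] assms(3) by (auto simp: integrable_on_def)
  have ie: "integral {c..e} (\<lambda>u. sin (real n * u)) = S e - S c"
    "integral {e..d} (\<lambda>u. sin (real n * u)) = S d - S e"
    using e int_sin by (auto intro!: integral_unique)
  have "((\<lambda>u. cos (real n * u)) has_integral sin (real n * d) / real n - sin (real n * c) / real n) {c..d}"
    using assms n
    by (intro fundamental_theorem_of_calculus)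
       (auto simp flip: has_real_derivative_iff_has_vector_derivative intro!: derivative_eq_intros)
  from has_integral_diff[OF has_integral_mult_right[OF this, of "1/2"] has_integral_mult_right[OF I[unfolded ie], of "1/2"]]
  have J: "((\<lambda>u. 1/2 * cos (real n * u) - 1/2 * (- cot (u / 2) * sin (real n * u))) has_integral
     1/2 * (sin (real n * d) / real n - sin (real n * c) / real n) + 1/2 * (cot (c/2) * (S e - S c) + cot (d/2) * (S d - S e))) {c..d}"
    by (simp add: algebra_simps)
  have eq: "dirichlet_kernel n u = 1/2 * cos (real n * u) - 1/2 * (- cot (u / 2) * sin (real n * u))"
    if "u \<in> {c..d}" for u
  proof -
    have "sin (u / 2) > 0" using that assms by (intro sin_gt_zero) auto
    then show ?thesis
      using dirichlet_kernel_closed_form[of u n] by (simp add: cot_def field_simps)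
  qed
  have K: "(dirichlet_kernel n has_integral dirichlet_primitive n d - dirichlet_primitive n c) {c..d}"
    using assms(3) dirichlet_primitive_deriv
    by (intro fundamental_theorem_of_calculus)
       (auto simp flip: has_real_derivative_iff_has_vector_derivative intro: DERIV_subset)
  have increment: "dirichlet_primitive n d - dirichlet_primitive n c =
    1/2 * (sin (real n * d) / real n - sin (real n * c) / real n) + 1/2 * (cot (c/2) * (S e - S c) + cot (d/2) * (S d - S e))"
    by (rule has_integral_unique[OF K has_integral_eq[OF eq[symmetric] J]])
  have sin_part: "\<bar>sin (real n * d) / real n - sin (real n * c) / real n\<bar> \<le> 2 / real n"
  proof -
    have "\<bar>sin (real n * d) - sin (real n * c)\<bar> \<le> 2"
      using abs_sin_le_one[of "real n * d"] abs_sin_le_one[of "real n * c"] by linarith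
    then show ?thesis
      using n by (simp add: divide_right_mono flip: diff_divide_distrib)
  qed
  have cot_bound: "\<bar>cot (u/2)\<bar> \<le> cot (\<delta>/2)" if "u \<in> {c..d}" for u
  proof -
    have "cot (u/2) \<le> cot (\<delta>/2)" "cot (pi - \<delta>/2) \<le> cot (u/2)"
      using that assms by (auto intro!: cot_antimono)
    moreover have "cot (pi - \<delta>/2) = - cot (\<delta>/2)"
      by (simp add: cot_def)
    ultimately show ?thesis by linarith
  qed
  have prod: "\<bar>cot (u/2) * (S q - S p)\<bar> \<le> cot (\<delta>/2) * (2 / real n)" if "u \<in> {c..d}" for u p q
    unfolding abs_mult using cot_bound[OF that] S_bound by (intro mult_mono) auto
  have aux: "\<bar>1/2 * x + 1/2 * (y + z)\<bar> \<le> 1/2 * B + 1/2 * (2 * C)"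
    if "\<bar>x\<bar> \<le> B" "\<bar>y\<bar> \<le> C" "\<bar>z\<bar> \<le> C" for x y z B C :: real
    using that by (auto simp: abs_le_iff add_divide_distrib)
  have "\<bar>dirichlet_primitive n d - dirichlet_primitive n c\<bar>
      \<le> 1/2 * (2 / real n) + 1/2 * (2 * (cot (\<delta>/2) * (2 / real n)))"
    unfolding increment using assms(3) by (intro aux sin_part prod) auto
  then show ?thesis
    by (simp add: add_divide_distrib mult.commute)
qed

text \<open>The cut at 1/n balances two estimates. Below it, each of the n sine terms is at most u,
  which gives 1/2 + 1. Above it, the increment bound with \<delta> = 1/n gives at most (1 + 4n)/n
  \<le> 5. The sum is 13/2.\<close>

lemma dirichlet_primitive_bound:
  assumes "\<bar>u\<bar> \<le> pi" "n \<ge> 1"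
  shows "\<bar>dirichlet_primitive n u\<bar> \<le> 13 / 2"
proof -
  have pos: "\<bar>dirichlet_primitive n u\<bar> \<le> 13 / 2" if u: "0 \<le> u" "u \<le> pi" for u
  proof -
    have small: "\<bar>dirichlet_primitive n u\<bar> \<le> 3 / 2" if "0 \<le> u" "u \<le> 1 / real n" for u
    proof -
      have "\<bar>\<Sum>k=1..n. sin (real k * u) / real k\<bar> \<le> (\<Sum>k=1..n. u)"
      proof (rule order_trans[OF sum_abs sum_mono])
        fix k assume "k \<in> {1..n}"
        moreover have "\<bar>sin (real k * u)\<bar> \<le> real k * u"
          using abs_sin_x_le_abs_x[of "real k * u"] that by simp
        ultimately show "\<bar>sin (real k * u) / real k\<bar> \<le> u"
          by (simp add: field_simps)
      qed
      also have "\<dots> \<le> 1" using that assms by (simp add: field_simps)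
      finally have "\<bar>\<Sum>k=1..n. sin (real k * u) / real k\<bar> \<le> 1" .
      moreover have "u \<le> 1"
        using that assms by (intro order_trans[OF that(2)]) simp
      ultimately show ?thesis
        using that(1) unfolding dirichlet_primitive_def by linarith
    qed
    show ?thesis
    proof (cases "u \<le> 1 / real n")
      case True
      then show ?thesis using small[OF u(1)] by linarith
    next
      case False
      have n: "0 < 1 / real n" "1 / real n \<le> 1" using assms by auto
      have "\<bar>dirichlet_primitive n u - dirichlet_primitive n (1 / real n)\<bar> \<le> (1 + 2 * cot ((1 / real n) / 2)) / real n"
        using False u n assms pi_gt3 by (intro dirichlet_primitive_increment_bound) auto
      also have "\<dots> \<le> (1 + 2 * (1 / ((1 / real n) / 2))) / real n"
        using cot_le_inverse[of "(1 / real n) / 2"] n pi_gt3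
        by (intro divide_right_mono add_left_mono mult_left_mono) auto
      also have "\<dots> \<le> 5" using assms by (simp add: field_simps)
      finally have "\<bar>dirichlet_primitive n u - dirichlet_primitive n (1 / real n)\<bar> \<le> 5" .
      then show ?thesis using small[of "1 / real n"] by simp
    qed
  qed
  show ?thesis
  proof (cases "0 \<le> u")
    case False
    then show ?thesis using pos[of "- u"] assms by simp
  qed (use pos assms in simp)
qed

section \<open>One-sided limits and Fourier integrals of controlled functions\<close>

lemma mono_one_sided_limits:
  fixes f :: "real \<Rightarrow> real"
  assumes x: "a < x" "x < b" and mono: "\<And>t u. a \<le> t \<Longrightarrow> t \<le> u \<Longrightarrow> u \<le> b \<Longrightarrow> f t \<le> f u"
  obtains l r where "(f \<longlongrightarrow> l) (at_left x)" "(f \<longlongrightarrow> r) (at_right x)"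
proof -
  have "at x within ({..<x} \<inter> {a..b}) = at_left x"
    by (rule at_within_nhd[of x "{a<..<b}"]) (use x in auto)
  moreover have "(f \<longlongrightarrow> Sup (f ` ({..<x} \<inter> {a..b}))) (at x within ({..<x} \<inter> {a..b}))"
    using mono x by (intro Lim_left_bound[where K = "f x"]) auto
  moreover have "at x within ({x<..} \<inter> {a..b}) = at_right x"
    by (rule at_within_nhd[of x "{a<..<b}"]) (use x in auto)
  moreover have "(f \<longlongrightarrow> Inf (f ` ({x<..} \<inter> {a..b}))) (at x within ({x<..} \<inter> {a..b}))"
    using mono x by (intro Lim_right_bound[where K = "f x"]) auto
  ultimately show thesis using that by simp
qed

text \<open>The control says precisely that \<open>W\<close>, \<open>W - g\<close> and
  \<open>W + g\<close> are nondecreasing, so g = W - (W - g) is a Jordan decomposition whose first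
  part does not depend on \<open>g\<close>.\<close>

lemma controlled_one_sided_limits:
  fixes g W :: "real \<Rightarrow> real"
  assumes x: "a < x" "x < b" and ctrl: "\<And>t u. a \<le> t \<Longrightarrow> t \<le> u \<Longrightarrow> u \<le> b \<Longrightarrow> \<bar>g t - g u\<bar> \<le> W u - W t"
  obtains l r where "(g \<longlongrightarrow> l) (at_left x)" "(g \<longlongrightarrow> r) (at_right x)"
proof -
  have mono: "W t \<le> W u" "W t - g t \<le> W u - g u" if "a \<le> t" "t \<le> u" "u \<le> b" for t u
    using ctrl[OF that] by linarith+
  obtain l1 r1 where 1: "(W \<longlongrightarrow> l1) (at_left x)" "(W \<longlongrightarrow> r1) (at_right x)"
    using mono_one_sided_limits[OF x, of W, OF mono(1)] by blast
  obtain l2 r2 where 2: "((\<lambda>t. W t - g t) \<longlongrightarrow> l2) (at_left x)" "((\<lambda>t. W t - g t) \<longlongrightarrow> r2) (at_right x)"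
    using mono_one_sided_limits[OF x, of "\<lambda>t. W t - g t", OF mono(2)] by blast
  show thesis
    using tendsto_diff[OF 1(1) 2(1)] tendsto_diff[OF 1(2) 2(2)] by (intro that) simp_all
qed

text \<open>The second mean value theorem is applied to \<open>W\<close> and to
  \<open>W - h\<close>, with unrelated intermediate points. The increments of these two functions
  are at most one and two times \<open>W q - W p\<close>, whence the factor 3. The reference value
  \<open>e\<close> will be a one-sided limit, which need not be a value of \<open>h\<close> on the
  interval.\<close>

lemma controlled_weighted_integral:
  fixes k h W :: "real \<Rightarrow> real"
  assumes k: "k integrable_on {p..q}" and "p \<le> q"
    and ctrl: "\<And>t u. p \<le> t \<Longrightarrow> t \<le> u \<Longrightarrow> u \<le> q \<Longrightarrow> \<bar>h t - h u\<bar> \<le> W u - W t"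
    and M: "\<And>c d. p \<le> c \<Longrightarrow> c \<le> d \<Longrightarrow> d \<le> q \<Longrightarrow> \<bar>integral {c..d} k\<bar> \<le> M"
  shows "(\<lambda>t. k t * h t) integrable_on {p..q}"
    and "\<bar>integral {p..q} (\<lambda>t. k t * h t) - e * integral {p..q} k\<bar> \<le> M * (3 * (W q - W p) + \<bar>h p - e\<bar>)"
proof -
  have "W t \<le> W u" "W t - h t \<le> W u - h u" if "p \<le> t" "t \<le> u" "u \<le> q" for t u
    using ctrl[OF that] by linarith+
  note mono = this
  obtain c1 where c1: "c1 \<in> {p..q}"
    and I1: "((\<lambda>t. W t * k t) has_integral (W p * integral {p..c1} k + W q * integral {c1..q} k)) {p..q}"
    using second_mean_value_theorem_full[OF k assms(2), of W] mono(1) by blast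
  obtain c2 where c2: "c2 \<in> {p..q}"
    and I2: "((\<lambda>t. (W t - h t) * k t) has_integral
      ((W p - h p) * integral {p..c2} k + (W q - h q) * integral {c2..q} k)) {p..q}"
    using second_mean_value_theorem_full[OF k assms(2), of "\<lambda>t. W t - h t"] mono(2) by blast
  have J: "((\<lambda>t. k t * h t) has_integral (W p * integral {p..c1} k + W q * integral {c1..q} k)
     - ((W p - h p) * integral {p..c2} k + (W q - h q) * integral {c2..q} k)) {p..q}"
    using has_integral_diff[OF I1 I2] by (simp add: algebra_simps)
  then show "(\<lambda>t. k t * h t) integrable_on {p..q}" by blast
  have split: "integral {p..c} k = integral {p..q} k - integral {c..q} k" if "c \<in> {p..q}" for c
    using Henstock_Kurzweil_Integration.integral_combine[of p c q k] k that by auto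
  \<comment> \<open>Writing every integral from \<open>p\<close> as the full integral minus an
    integral up to \<open>q\<close> collects the value \<open>h p\<close> in front of the full
    integral and leaves only increments elsewhere.\<close>
  have "integral {p..q} (\<lambda>t. k t * h t) - e * integral {p..q} k =
    (W q - W p) * integral {c1..q} k - ((W q - W p) + (h p - h q)) * integral {c2..q} k + (h p - e) * integral {p..q} k"
    unfolding integral_unique[OF J] split[OF c1] split[OF c2] by (simp add: algebra_simps)
  also have "\<bar>\<dots>\<bar> \<le> (W q - W p) * M + (2 * (W q - W p)) * M + \<bar>h p - e\<bar> * M"
  proof -
    have b: "\<bar>h p - h q\<bar> \<le> W q - W p" using ctrl assms(2) by simp
    have "\<bar>(W q - W p) * integral {c1..q} k\<bar> \<le> (W q - W p) * M"
      unfolding abs_mult using b c1 c2 assms(2) by (intro mult_mono M) auto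
    moreover have "\<bar>((W q - W p) + (h p - h q)) * integral {c2..q} k\<bar> \<le> (2 * (W q - W p)) * M"
      unfolding abs_mult using b c1 c2 assms(2) by (intro mult_mono M) auto
    moreover have "\<bar>(h p - e) * integral {p..q} k\<bar> \<le> \<bar>h p - e\<bar> * M"
      unfolding abs_mult using assms(2) by (intro mult_mono M) auto
    ultimately show ?thesis by linarith
  qed
  finally show "\<bar>integral {p..q} (\<lambda>t. k t * h t) - e * integral {p..q} k\<bar> \<le> M * (3 * (W q - W p) + \<bar>h p - e\<bar>)"
    by (simp add: algebra_simps)
qed


text \<open>The interval is cut at x - \<delta>, x and x + \<delta>, and on each piece
  \<open>g\<close> is compared with the one-sided limit on its side of \<open>x\<close>. Near
  \<open>x\<close> the kernel integrals are merely bounded, but the control varies little; far from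
  \<open>x\<close> they are small, and the control contributes its total increase.\<close>

lemma fourier_integral_jump_bound:
  fixes g W :: "real \<Rightarrow> real"
  defines "\<And>n. P n \<equiv> dirichlet_primitive n"
  assumes \<delta>: "0 < \<delta>" "\<bar>x\<bar> + \<delta> \<le> pi" and n: "n \<ge> 1"
    and ctrl: "\<And>t u. - pi \<le> t \<Longrightarrow> t \<le> u \<Longrightarrow> u \<le> pi \<Longrightarrow> \<bar>g t - g u\<bar> \<le> W u - W t"
    and left: "(g \<longlongrightarrow> gl) (at_left x)" "(W \<longlongrightarrow> wl) (at_left x)"
    and right: "(g \<longlongrightarrow> gr) (at_right x)" "(W \<longlongrightarrow> wr) (at_right x)"
  shows "\<bar>integral {- pi..pi} (\<lambda>t. dirichlet_kernel n (x - t) * g t) - pi / 2 * (gl + gr)\<bar>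
     \<le> 52 * ((wl - W (x - \<delta>)) + (W (x + \<delta>) - wr))
       + 4 * (W pi - W (- pi)) * ((1 + 2 * cot (\<delta> / 2)) / real n)"
proof -
  define k where "k = (\<lambda>t. dirichlet_kernel n (x - t))"
  define M where "M = (1 + 2 * cot (\<delta> / 2)) / real n"
  \<comment> \<open>Redefining \<open>g\<close> and \<open>W\<close> at \<open>x\<close>, separately
    for each side, makes the control valid up to the endpoint \<open>x\<close> with the one-sided
    limits as endpoint values. The jump of \<open>g\<close> is thus kept out of the near
    pieces.\<close>
  define hl where "hl = (\<lambda>t. if t = x then gl else g t)"
  define Wl where "Wl = (\<lambda>t. if t = x then wl else W t)"
  define hr where "hr = (\<lambda>t. if t = x then gr else g t)"
  define Wr where "Wr = (\<lambda>t. if t = x then wr else W t)"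
  have x: "- pi < x" "x < pi" using \<delta> by auto
  have ctrl_left: "\<bar>g t - gl\<bar> \<le> wl - W t" if t: "- pi \<le> t" "t < x" for t
  proof (rule tendsto_le[OF trivial_limit_at_left_real])
    show "((\<lambda>u. W u - W t) \<longlongrightarrow> wl - W t) (at_left x)"
      and "((\<lambda>u. \<bar>g t - g u\<bar>) \<longlongrightarrow> \<bar>g t - gl\<bar>) (at_left x)"
      by (intro tendsto_intros left)+
    show "eventually (\<lambda>u. \<bar>g t - g u\<bar> \<le> W u - W t) (at_left x)"
      unfolding eventually_at_left_field
      using t x by (intro exI[of _ t]) (auto intro!: ctrl)
  qed
  have ctrl_right: "\<bar>gr - g t\<bar> \<le> W t - wr" if t: "x < t" "t \<le> pi" for t
  proof (rule tendsto_le[OF trivial_limit_at_right_real])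
    show "((\<lambda>u. W t - W u) \<longlongrightarrow> W t - wr) (at_right x)"
      and "((\<lambda>u. \<bar>g u - g t\<bar>) \<longlongrightarrow> \<bar>gr - g t\<bar>) (at_right x)"
      by (intro tendsto_intros right)+
    show "eventually (\<lambda>u. \<bar>g u - g t\<bar> \<le> W t - W u) (at_right x)"
      unfolding eventually_at_right_field
      using t x by (intro exI[of _ t]) (auto intro!: ctrl)
  qed
  have jump: "\<bar>gl - gr\<bar> \<le> wr - wl"
  proof -
    \<comment> \<open>Two limits in succession: \<open>u\<close> tends to \<open>x\<close> from the
      right with \<open>t\<close> fixed, afterwards \<open>t\<close> tends to \<open>x\<close> from
      the left.\<close>
    have "\<bar>g t - gr\<bar> \<le> wr - W t" if t: "- pi \<le> t" "t < x" for t
    proof (rule tendsto_le[OF trivial_limit_at_right_real])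
      show "((\<lambda>u. W u - W t) \<longlongrightarrow> wr - W t) (at_right x)"
        and "((\<lambda>u. \<bar>g t - g u\<bar>) \<longlongrightarrow> \<bar>g t - gr\<bar>) (at_right x)"
        by (intro tendsto_intros right)+
      show "eventually (\<lambda>u. \<bar>g t - g u\<bar> \<le> W u - W t) (at_right x)"
        unfolding eventually_at_right_field
        using t x by (intro exI[of _ pi]) (auto intro!: ctrl)
    qed
    note * = this
    show ?thesis
    proof (rule tendsto_le[OF trivial_limit_at_left_real])
      show "((\<lambda>t. wr - W t) \<longlongrightarrow> wr - wl) (at_left x)"
        and "((\<lambda>t. \<bar>g t - gr\<bar>) \<longlongrightarrow> \<bar>gl - gr\<bar>) (at_left x)"
        by (intro tendsto_intros left)+
      show "eventually (\<lambda>t. \<bar>g t - gr\<bar> \<le> wr - W t) (at_left x)"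
        unfolding eventually_at_left_field
        using x * by (intro exI[of _ "- pi"]) auto
    qed
  qed
  have ctrl_l: "\<bar>hl t - hl u\<bar> \<le> Wl u - Wl t" if "- pi \<le> t" "t \<le> u" "u \<le> x" for t u
    using that x ctrl[of t u] ctrl_left[of t] by (auto simp: hl_def Wl_def)
  have ctrl_r: "\<bar>hr t - hr u\<bar> \<le> Wr u - Wr t" if "x \<le> t" "t \<le> u" "u \<le> pi" for t u
    using that x ctrl[of t u] ctrl_right[of u] by (auto simp: hr_def Wr_def)

  have k_int: "integral {c..d} k = P n (x - c) - P n (x - d)" if "c \<le> d" for c d
    unfolding k_def P_def by (rule integral_unique[OF dirichlet_kernel_has_integral[OF that]])
  have k_on: "k integrable_on {c..d}" if "c \<le> d" for c d
    unfolding k_def using dirichlet_kernel_has_integral[OF that] by (auto simp: integrable_on_def)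
  \<comment> \<open>13 is twice the uniform bound 13/2 of the primitive.\<close>
  have near: "\<bar>integral {c..d} k\<bar> \<le> 13" if "c \<le> d" "\<bar>x - c\<bar> \<le> pi" "\<bar>x - d\<bar> \<le> pi" for c d
    using dirichlet_primitive_bound[OF that(2) n] dirichlet_primitive_bound[OF that(3) n]
    by (simp add: k_int[OF that(1)] P_def)
  have far_left: "\<bar>integral {c..d} k\<bar> \<le> M" if "- pi \<le> c" "c \<le> d" "d \<le> x - \<delta>" for c d
    using dirichlet_primitive_increment_bound[of \<delta> "x - d" "x - c" n] that \<delta> n
    by (simp add: k_int P_def M_def)
  have far_right: "\<bar>integral {c..d} k\<bar> \<le> M" if "x + \<delta> \<le> c" "c \<le> d" "d \<le> pi" for c d
  proof -
    have "\<bar>P n (d - x) - P n (c - x)\<bar> \<le> M"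
      using dirichlet_primitive_increment_bound[of \<delta> "c - x" "d - x" n] that \<delta> n
      by (simp add: P_def M_def)
    moreover have "P n (x - c) = - P n (c - x)" "P n (x - d) = - P n (d - x)"
      using dirichlet_primitive_minus[of n "c - x"] dirichlet_primitive_minus[of n "d - x"]
      by (simp_all add: P_def)
    ultimately show ?thesis using that by (simp add: k_int)
  qed

  define L1 where "L1 = integral {- pi..x - \<delta>} (\<lambda>t. k t * hl t) - gl * integral {- pi..x - \<delta>} k"
  define L2 where "L2 = integral {x - \<delta>..x} (\<lambda>t. k t * hl t) - gl * integral {x - \<delta>..x} k"
  define R1 where "R1 = integral {x + \<delta>..pi} (\<lambda>t. k t * hr t) - gr * integral {x + \<delta>..pi} k"
  define R2 where "R2 = integral {x..x + \<delta>} (\<lambda>t. k t * hr t) - gr * integral {x..x + \<delta>} k"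
  have ordl: "- pi \<le> x - \<delta>" "x - \<delta> \<le> x" and ordr: "x + \<delta> \<le> pi" "x \<le> x + \<delta>" using \<delta> by auto
  note cwi = controlled_weighted_integral[OF k_on]
  have L1: "(\<lambda>t. k t * hl t) integrable_on {- pi..x - \<delta>}"
    "\<bar>L1\<bar> \<le> M * (3 * (Wl (x - \<delta>) - Wl (- pi)) + \<bar>hl (- pi) - gl\<bar>)"
    unfolding L1_def using ordl
    by - (rule cwi[where h = hl and W = Wl and M = M], (intro ctrl_l far_left | linarith)+)+
  have L2: "(\<lambda>t. k t * hl t) integrable_on {x - \<delta>..x}"
    "\<bar>L2\<bar> \<le> 13 * (3 * (Wl x - Wl (x - \<delta>)) + \<bar>hl (x - \<delta>) - gl\<bar>)"
    unfolding L2_def using ordl \<delta>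
    by - (rule cwi[where h = hl and W = Wl and M = 13], (intro ctrl_l near | linarith)+)+
  have R1: "(\<lambda>t. k t * hr t) integrable_on {x + \<delta>..pi}"
    "\<bar>R1\<bar> \<le> M * (3 * (Wr pi - Wr (x + \<delta>)) + \<bar>hr (x + \<delta>) - gr\<bar>)"
    unfolding R1_def using ordr
    by - (rule cwi[where h = hr and W = Wr and M = M], (intro ctrl_r far_right | linarith)+)+
  have R2: "(\<lambda>t. k t * hr t) integrable_on {x..x + \<delta>}"
    "\<bar>R2\<bar> \<le> 13 * (3 * (Wr (x + \<delta>) - Wr x) + \<bar>hr x - gr\<bar>)"
    unfolding R2_def using ordr \<delta>
    by - (rule cwi[where h = hr and W = Wr and M = 13], (intro ctrl_r near | linarith)+)+
  note comb = Henstock_Kurzweil_Integration.integral_combine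
  note icomb = Henstock_Kurzweil_Integration.integrable_combine
  have kl: "(\<lambda>t. k t * hl t) integrable_on {- pi..x}" and kr: "(\<lambda>t. k t * hr t) integrable_on {x..pi}"
    using icomb[OF ordl L1(1) L2(1)] icomb[OF ordr(2,1) R2(1) R1(1)] by auto
  have gl_int: "((\<lambda>t. k t * g t) has_integral integral {- pi..x} (\<lambda>t. k t * hl t)) {- pi..x}"
    using has_integral_spike_finite[of "{x}" "{- pi..x}" "\<lambda>t. k t * g t" "\<lambda>t. k t * hl t"] integrable_integral[OF kl]
    by (auto simp: hl_def)
  have gr_int: "((\<lambda>t. k t * g t) has_integral integral {x..pi} (\<lambda>t. k t * hr t)) {x..pi}"
    using has_integral_spike_finite[of "{x}" "{x..pi}" "\<lambda>t. k t * g t" "\<lambda>t. k t * hr t"] integrable_integral[OF kr]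
    by (auto simp: hr_def)
  have "integral {- pi..pi} (\<lambda>t. k t * g t)
      = integral {- pi..x} (\<lambda>t. k t * hl t) + integral {x..pi} (\<lambda>t. k t * hr t)"
    using has_integral_combine[OF _ _ gl_int gr_int] x by (auto intro: integral_unique)
  also have "integral {- pi..x} (\<lambda>t. k t * hl t) = L1 + L2 + gl * integral {- pi..x} k"
    using x by (simp add: L1_def L2_def distrib_left
        flip: comb[OF ordl kl] comb[OF ordl k_on])
  also have "integral {x..pi} (\<lambda>t. k t * hr t) = R1 + R2 + gr * integral {x..pi} k"
    using x by (simp add: R1_def R2_def distrib_left
        flip: comb[OF ordr(2,1) kr] comb[OF ordr(2,1) k_on])
  also have "integral {- pi..x} k = P n (x + pi)"
    using x k_int[of "- pi" x] by (simp add: P_def)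
  also have "integral {x..pi} k = pi - P n (x + pi)"
  proof -
    have "P n (x - pi) = - P n (2 * pi - (x + pi))"
      using dirichlet_primitive_minus[of n "pi - x"] by (simp add: P_def algebra_simps)
    then show ?thesis
      using x k_int[of x pi] dirichlet_primitive_reflect[of n "x + pi"] by (simp add: P_def)
  qed
  \<comment> \<open>The two kernel masses add up to pi, so replacing each by pi / 2 costs the last
    summand, the defect at the jump.\<close>
  finally have eq: "integral {- pi..pi} (\<lambda>t. k t * g t) - pi / 2 * (gl + gr)
      = L1 + L2 + R1 + R2 + (gl - gr) * (P n (x + pi) - pi / 2)"
    by (simp add: field_simps)
  \<comment> \<open>Since pi / 2 is the value of the primitive at pi, this is an increment between
    pi and x + pi, both of which lie between \<delta> and 2 pi - \<delta>.\<close>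
  have "\<bar>P n (x + pi) - pi / 2\<bar> \<le> M"
  proof (cases "0 \<le> x")
    case True
    then show ?thesis
      using dirichlet_primitive_increment_bound[of \<delta> pi "x + pi" n] \<delta> n by (simp add: P_def M_def)
  next
    case False
    then show ?thesis
      using dirichlet_primitive_increment_bound[of \<delta> "x + pi" pi n] \<delta> n by (simp add: P_def M_def)
  qed
  then have "\<bar>(gl - gr) * (P n (x + pi) - pi / 2)\<bar> \<le> M * \<bar>gl - gr\<bar>"
    by (simp add: abs_mult mult.commute[of M] mult_left_mono)
  moreover have M0: "0 \<le> M" using far_left[of "- pi" "- pi"] ordl by simp
  have inner: "W (- pi) \<le> W (x - \<delta>)" "W (x - \<delta>) \<le> wl" "wl \<le> wr" "wr \<le> W (x + \<delta>)" "W (x + \<delta>) \<le> W pi"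
    using ctrl[of "- pi" "x - \<delta>"] ctrl[of "x + \<delta>" pi] ctrl_left[of "x - \<delta>"] ctrl_right[of "x + \<delta>"] jump ordl ordr \<delta> x
    by auto
  have "\<bar>L1\<bar> \<le> M * (4 * (wl - W (- pi)))"
    using L1(2) ctrl_left[of "- pi"] inner x \<delta>
    by (elim order_trans, intro mult_left_mono[OF _ M0]) (auto simp: hl_def Wl_def)
  moreover have "\<bar>R1\<bar> \<le> M * (4 * (W pi - wr))"
    using R1(2) ctrl_right[of "x + \<delta>"] inner x \<delta> ordr
    by (elim order_trans, intro mult_left_mono[OF _ M0]) (auto simp: hr_def Wr_def)
  moreover have "\<bar>L2\<bar> \<le> 52 * (wl - W (x - \<delta>))"
    using L2(2) ctrl_left[of "x - \<delta>"] x \<delta> ordl by (auto simp: hl_def Wl_def)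
  \<comment> \<open>Here the reference value is the value of \<open>hr\<close> at the left endpoint,
    so only 3 * 13 remains; on the left side the extra term makes it 4 * 13 = 52.\<close>
  moreover have "\<bar>R2\<bar> \<le> 39 * (W (x + \<delta>) - wr)"
    using R2(2) x \<delta> by (auto simp: hr_def Wr_def)
  \<comment> \<open>The increase of \<open>W\<close> up to \<open>wl\<close>, the jump from
    \<open>wl\<close> to \<open>wr\<close> and the increase after \<open>wr\<close> add up to the
    total increase, so the defect is absorbed by the far pieces.\<close>
  moreover have "M * \<bar>gl - gr\<bar> + M * (4 * (wl - W (- pi))) + M * (4 * (W pi - wr)) \<le> 4 * (W pi - W (- pi)) * M"
    using mult_left_mono[OF jump M0] mult_left_mono[of "wl" wr M, OF _ M0] inner by (simp add: algebra_simps)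
  moreover have "\<bar>l1 + l2 + r1 + r2 + J\<bar> \<le> 52 * (dl + dr) + Q"
    if "\<bar>J\<bar> \<le> A" "\<bar>l1\<bar> \<le> A1" "\<bar>r1\<bar> \<le> A2" "\<bar>l2\<bar> \<le> 52 * dl" "\<bar>r2\<bar> \<le> 39 * dr"
      "A + A1 + A2 \<le> Q" "0 \<le> dr" for l1 l2 r1 r2 J A A1 A2 dl dr Q :: real
    using that by (auto simp: abs_le_iff)
  ultimately have "\<bar>integral {- pi..pi} (\<lambda>t. k t * g t) - pi / 2 * (gl + gr)\<bar>
     \<le> 52 * ((wl - W (x - \<delta>)) + (W (x + \<delta>) - wr)) + 4 * (W pi - W (- pi)) * M"
    unfolding eq using inner(4) by simp
  then show ?thesis by (simp add: k_def M_def)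
qed

section \<open>Norms, metric pairs and partitions\<close>

lemma is_normD:
  assumes "is_norm N"
  shows "0 \<le> N x" "N 0 = 0" "N (c *\<^sub>R x) = \<bar>c\<bar> * N x" "N (x + y) \<le> N x + N y"
    "N x = 0 \<longleftrightarrow> x = 0" "N (- x) = N x" "N (x - y) = N (y - x)" "N (x - z) \<le> N (x - y) + N (y - z)"
proof -
  show *: "0 \<le> N x" "N 0 = 0" "N (c *\<^sub>R x) = \<bar>c\<bar> * N x" "N (x + y) \<le> N x + N y" "N x = 0 \<longleftrightarrow> x = 0" for x y c
    using assms by (auto simp: is_norm_def)
  show m: "N (- x) = N x" for x
    using *(3)[of "- 1" x] by simp
  show "N (x - y) = N (y - x)"
    using m[of "x - y"] by simp
  show "N (x - z) \<le> N (x - y) + N (y - z)"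
    using *(4)[of "x - y" "y - z"] by simp
qed

text \<open>The triangle inequality and homogeneity make \<open>N\<close> convex, and finite convex
  functions on a finite-dimensional space are continuous.\<close>

lemma is_norm_continuous:
  fixes N :: "'a::euclidean_space \<Rightarrow> real"
  assumes "is_norm N"
  shows "continuous_on UNIV N"
proof (rule convex_on_continuous)
  show "convex_on UNIV N"
  proof (rule convex_onI)
    fix t :: real and x y :: 'a
    assume "0 < t" "t < 1"
    then show "N ((1 - t) *\<^sub>R x + t *\<^sub>R y) \<le> (1 - t) * N x + t * N y"
      using is_normD(4)[OF assms, of "(1 - t) *\<^sub>R x" "t *\<^sub>R y"] by (simp add: is_normD(3)[OF assms])
  qed simp
qed simp

lemma is_norm_tendsto:
  fixes N :: "'a::euclidean_space \<Rightarrow> real"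
  assumes "is_norm N" "(f \<longlongrightarrow> l) G"
  shows "((\<lambda>x. N (f x)) \<longlongrightarrow> N l) G"
  by (rule continuous_on_tendsto_compose[OF is_norm_continuous[OF assms(1)] assms(2)]) simp_all

text \<open>\<open>C\<close> is the reciprocal of the minimum of \<open>N\<close> on the Euclidean
  unit sphere, which is attained and positive.\<close>

lemma is_norm_dominates_norm:
  fixes N :: "'a::euclidean_space \<Rightarrow> real"
  assumes "is_norm N"
  obtains C where "C > 0" "\<And>z. norm z \<le> C * N z"
proof -
  obtain w :: 'a where w: "w \<in> sphere 0 1" "\<And>z. z \<in> sphere 0 1 \<Longrightarrow> N w \<le> N z"
    using continuous_attains_inf[of "sphere 0 1" N] continuous_on_subset[OF is_norm_continuous[OF assms]]
    by (metis compact_sphere subset_UNIV zero_le_one vector_choose_size mem_sphere_0 empty_iff)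
  have pos: "N w > 0"
    using w(1) is_normD(1,5)[OF assms, of w] by (force simp: less_le)
  have "norm z \<le> (1 / N w) * N z" for z
  proof (cases "z = 0")
    case False
    then have "N w \<le> N ((1 / norm z) *\<^sub>R z)" by (intro w(2)) simp
    then show ?thesis
      using False pos by (simp add: is_normD(3)[OF assms] field_simps)
  qed (simp add: is_normD(2)[OF assms])
  with pos show thesis by (intro that[of "1 / N w"]) auto
qed

text \<open>The Fourier estimate is scalar and is applied to each component; this inequality
  assembles the components into a bound for \<open>N\<close>.\<close>

lemma is_norm_le_sum_components:
  fixes N :: "real ^ 'd \<Rightarrow> real"
  assumes "is_norm N"
  obtains C where "C > 0" "\<And>z. N z \<le> C * (\<Sum>j\<in>UNIV. \<bar>z $ j\<bar>)"
proof -
  define C where "C = 1 + (\<Sum>j\<in>UNIV. N (axis j 1))"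
  have N_sum: "N (sum f I) \<le> (\<Sum>i\<in>I. N (f i))" if "finite I" for f :: "'d \<Rightarrow> real ^ 'd" and I
    using that
  proof (induction rule: finite_induct)
    case (insert i I)
    then show ?case using is_normD(4)[OF assms, of "f i" "sum f I"] by simp
  qed (simp add: is_normD(2)[OF assms])
  have C: "N (axis j 1) \<le> C" for j
    using member_le_sum[of j UNIV "\<lambda>j. N (axis j 1)"] is_normD(1)[OF assms] by (simp add: C_def add_increasing)
  have "N z \<le> C * (\<Sum>j\<in>UNIV. \<bar>z $ j\<bar>)" for z
  proof -
    have "z = (\<Sum>j\<in>UNIV. (z $ j) *\<^sub>R axis j 1)"
      using basis_expansion[of z] by (simp add: scalar_mult_eq_scaleR)
    then have "N z \<le> (\<Sum>j\<in>UNIV. N ((z $ j) *\<^sub>R axis j 1))"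
      using N_sum[of UNIV "\<lambda>j. (z $ j) *\<^sub>R axis j 1"] by simp
    also have "\<dots> \<le> (\<Sum>j\<in>UNIV. C * \<bar>z $ j\<bar>)"
      using C by (intro sum_mono) (simp add: is_normD(3)[OF assms] mult.commute[of C] mult_left_mono)
    finally show ?thesis by (simp add: sum_distrib_left)
  qed
  moreover have "C > 0"
    using sum_nonneg[of UNIV "\<lambda>j. N (axis j 1)"] is_normD(1)[OF assms] by (simp add: C_def add_pos_nonneg)
  ultimately show thesis using that by blast
qed

section \<open>Hausdorff distance and metric pairs\<close>

lemma haus_commute: "haus N A B = haus N B A"
  by (simp add: haus_def max.commute)

lemma metric_pair_le_haus:
  assumes "(a, b) \<in> metric_pairs N A B"
  shows "ennreal (N (a - b)) \<le> haus N A B"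
proof -
  have "pt_dist N a B \<le> haus N A B" if "a \<in> A"
    unfolding haus_def using that by (intro max.coboundedI1 SUP_upper)
  moreover have "pt_dist N b A \<le> haus N A B" if "b \<in> B"
    unfolding haus_def using that by (intro max.coboundedI2 SUP_upper)
  ultimately show ?thesis
    using assms unfolding metric_pairs_def by auto
qed

text \<open>A nearest point of a compact set is attained. It is used to prolong a metric chain by
  one more set.\<close>

lemma metric_pair_exists:
  fixes N :: "'a::euclidean_space \<Rightarrow> real"
  assumes "is_norm N" "a \<in> A" "compact B" "B \<noteq> {}"
  obtains b where "(a, b) \<in> metric_pairs N A B"
proof -
  have "continuous_on B (\<lambda>d. N (a - d))"
    by (intro continuous_on_compose2[OF is_norm_continuous[OF assms(1)]] continuous_intros) auto
  then obtain b where b: "b \<in> B" "\<And>d. d \<in> B \<Longrightarrow> N (a - b) \<le> N (a - d)"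
    using continuous_attains_inf[OF assms(3,4)] by blast
  then have "ennreal (N (a - b)) = pt_dist N a B"
    unfolding pt_dist_def by (intro antisym INF_greatest INF_lower2[of b] ennreal_leI) auto
  with b assms(2) show thesis
    by (intro that[of b]) (simp add: metric_pairs_def)
qed

text \<open>Pairing \<open>f s\<close> with \<open>g s\<close> bounds both one-sided distances at
  once. Both sets of the final estimate are images of the same set of selections.\<close>

lemma haus_image_le:
  assumes "\<And>s. s \<in> S \<Longrightarrow> N (f s - g s) \<le> r" "\<And>x y. N (x - y) = N (y - x)"
  shows "haus N (f ` S) (g ` S) \<le> ennreal r"
  unfolding haus_def pt_dist_def
proof (intro max.boundedI SUP_least)
  fix y assume "y \<in> f ` S"
  then obtain s where "s \<in> S" "y = f s" by blast
  then show "(INF d\<in>g ` S. ennreal (N (y - d))) \<le> ennreal r"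
    using assms(1) by (intro INF_lower2[of "g s"] ennreal_leI) auto
next
  fix y assume "y \<in> g ` S"
  then obtain s where "s \<in> S" "y = g s" by blast
  then show "(INF d\<in>f ` S. ennreal (N (y - d))) \<le> ennreal r"
    using assms(1)[of s] assms(2)[of "f s" "g s"] by (intro INF_lower2[of "f s"] ennreal_leI) auto
qed

section \<open>Partitions, their points below a given argument, and chain functions\<close>

lemma is_partitionD:
  assumes "is_partition a b n \<xi>"
  shows "\<xi> 0 = a" "\<xi> n = b" "i < n \<Longrightarrow> \<xi> i < \<xi> (Suc i)"
  using assms unfolding is_partition_def by blast+

lemma is_partition_mono:
  assumes "is_partition a b n \<xi>" "i \<le> j" "j \<le> n"
  shows "\<xi> i \<le> \<xi> j"
  using assms(2,3)
proof (induction j rule: dec_induct)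
  case (step j)
  then show ?case using is_partitionD(3)[OF assms(1), of j] by linarith
qed simp

lemma is_partition_range:
  assumes "is_partition a b n \<xi>" "i \<le> n"
  shows "\<xi> i \<in> {a..b}"
proof -
  have "\<xi> 0 = a" "\<xi> n = b" using is_partitionD[OF assms(1)] by simp_all
  then show ?thesis
    using is_partition_mono[OF assms(1), of 0 i] is_partition_mono[OF assms(1), of i n] assms(2) by simp
qed

text \<open>This isolates the index hidden in \<open>chain_fun\<close>, so that a chain value and
  the partition point it belongs to can be addressed together.\<close>

definition part_index :: "nat \<Rightarrow> (nat \<Rightarrow> real) \<Rightarrow> real \<Rightarrow> nat" where
  "part_index n \<xi> t = (if t = \<xi> n then n else THE i. i < n \<and> t \<in> {\<xi> i..<\<xi> (Suc i)})"

lemma chain_fun_eq: "chain_fun n \<xi> y t = y (part_index n \<xi> t)"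
  by (simp add: chain_fun_def part_index_def)

lemma part_index_eq:
  assumes p: "is_partition a b n \<xi>" and i: "i < n" "\<xi> i \<le> t" "t < \<xi> (Suc i)"
  shows "part_index n \<xi> t = i"
proof -
  have unique: "j = i" if "j < n" "\<xi> j \<le> t" "t < \<xi> (Suc j)" for j
  proof (rule linorder_cases[of i j])
    assume "i < j"
    then have "\<xi> (Suc i) \<le> \<xi> j" using that by (intro is_partition_mono[OF p]) auto
    with that i show ?thesis by linarith
  next
    assume "j < i"
    then have "\<xi> (Suc j) \<le> \<xi> i" using i by (intro is_partition_mono[OF p]) auto
    with that i show ?thesis by linarith
  qed simp
  have "\<xi> (Suc i) \<le> \<xi> n" using i by (intro is_partition_mono[OF p]) auto
  then have "t \<noteq> \<xi> n" using i by linarith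
  moreover have "(THE i. i < n \<and> t \<in> {\<xi> i..<\<xi> (Suc i)}) = i"
  proof (rule the_equality)
    show "i < n \<and> t \<in> {\<xi> i..<\<xi> (Suc i)}" using i by simp
    show "j = i" if "j < n \<and> t \<in> {\<xi> j..<\<xi> (Suc j)}" for j
      using that by (intro unique) auto
  qed
  ultimately show ?thesis unfolding part_index_def by (simp only: if_False)
qed

lemma part_index_cases:
  assumes p: "is_partition a b n \<xi>" and t: "t \<in> {a..b}"
  obtains "t = b" "part_index n \<xi> t = n"
    | "t < b" "part_index n \<xi> t < n" "\<xi> (part_index n \<xi> t) \<le> t" "t < \<xi> (Suc (part_index n \<xi> t))"
proof (cases "t = b")
  case True
  then show thesis using is_partitionD(2)[OF p] that(1) by (simp add: part_index_def)
next
  case False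
  define j where "j = (LEAST j. t < \<xi> j)"
  have "t < \<xi> n" using is_partitionD(2)[OF p] False t by simp
  then have j: "t < \<xi> j" "j \<le> n"
    unfolding j_def by (rule LeastI[of "\<lambda>j. t < \<xi> j"], rule Least_le[of "\<lambda>j. t < \<xi> j"])
  moreover have "j \<noteq> 0" using j(1) t is_partitionD(1)[OF p] by (intro notI) simp
  then obtain i where i: "j = Suc i" using not0_implies_Suc by blast
  moreover have "\<xi> i \<le> t"
    using not_less_Least[of i "\<lambda>j. t < \<xi> j"] i unfolding j_def[symmetric] by simp
  ultimately show thesis
    using part_index_eq[OF p, of i t] that(2) False t by simp
qed

lemma part_index_le:
  assumes "is_partition a b n \<xi>" "t \<in> {a..b}"
  shows "part_index n \<xi> t \<le> n" "\<xi> (part_index n \<xi> t) \<le> t"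
proof -
  have "part_index n \<xi> t \<le> n \<and> \<xi> (part_index n \<xi> t) \<le> t"
    using is_partitionD(2)[OF assms(1)] by (cases rule: part_index_cases[OF assms]) simp_all
  then show "part_index n \<xi> t \<le> n" "\<xi> (part_index n \<xi> t) \<le> t" by blast+
qed

lemma part_index_mono:
  assumes p: "is_partition a b n \<xi>" and "t \<in> {a..b}" "u \<in> {a..b}" "t \<le> u"
  shows "part_index n \<xi> t \<le> part_index n \<xi> u"
proof (cases rule: part_index_cases[OF p assms(3)])
  case 1
  then show ?thesis using part_index_le[OF p assms(2)] by simp
next
  case 2
  show ?thesis
  proof (rule ccontr)
    assume "\<not> ?thesis"
    then have "\<xi> (Suc (part_index n \<xi> u)) \<le> \<xi> (part_index n \<xi> t)"
      using part_index_le[OF p assms(2)] by (intro is_partition_mono[OF p]) auto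
    then show False using part_index_le[OF p assms(2)] 2 assms(4) by simp
  qed
qed

lemma part_index_mesh:
  assumes p: "is_partition a b n \<xi>" "a < b" and t: "t \<in> {a..b}"
  shows "t - \<xi> (part_index n \<xi> t) \<le> mesh n \<xi>"
proof -
  have step: "\<xi> (Suc i) - \<xi> i \<le> mesh n \<xi>" if "i < n" for i
    unfolding mesh_def using that by (intro Max_ge) auto
  \<comment> \<open>\<open>mesh\<close> is a maximum over \<open>{..<n}\<close>, which must be
    nonempty to yield \<open>0 \<le> mesh n \<xi>\<close>; this is what the endpoint t = b
    requires.\<close>
  have "n \<noteq> 0" using is_partitionD(1,2)[OF p(1)] p(2) by (intro notI) simp
  then have "0 \<le> mesh n \<xi>" using step[of 0] is_partition_mono[OF p(1), of 0 1] by simp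
  then show ?thesis
    using step[of "part_index n \<xi> t"] is_partitionD(2)[OF p(1)]
    by (cases rule: part_index_cases[OF p(1) t]) simp_all
qed

lemma part_point_tendsto:
  assumes p: "\<And>k. is_partition a b (n k) (\<xi> k)" and "a < b"
    and mesh: "(\<lambda>k. mesh (n k) (\<xi> k)) \<longlonglongrightarrow> 0" and t: "t \<in> {a..b}"
  shows "(\<lambda>k. \<xi> k (part_index (n k) (\<xi> k) t)) \<longlonglongrightarrow> t"
proof (rule real_tendsto_sandwich[OF always_eventually always_eventually])
  show "\<forall>k. t - mesh (n k) (\<xi> k) \<le> \<xi> k (part_index (n k) (\<xi> k) t)"
    using part_index_mesh[OF p assms(2) t] by (simp add: algebra_simps)
  show "\<forall>k. \<xi> k (part_index (n k) (\<xi> k) t) \<le> t"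
    using part_index_le(2)[OF p t] by blast
  show "(\<lambda>k. t - mesh (n k) (\<xi> k)) \<longlonglongrightarrow> t"
    using tendsto_diff[OF tendsto_const mesh, of t] by simp
qed simp

text \<open>The values \<open>z\<close> are arbitrary, so that chain elements already multiplied by
  the weight can be inserted. On each piece the function is constant except possibly at the right
  endpoint.\<close>

lemma chain_fun_has_integral:
  fixes z :: "nat \<Rightarrow> 'a::banach"
  assumes p: "is_partition a b n \<xi>"
  shows "(chain_fun n \<xi> z has_integral (\<Sum>i<n. (\<xi> (Suc i) - \<xi> i) *\<^sub>R z i)) {a..b}"
proof -
  have "(chain_fun n \<xi> z has_integral (\<Sum>i<m. (\<xi> (Suc i) - \<xi> i) *\<^sub>R z i)) {\<xi> 0..\<xi> m}" if "m \<le> n" for m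
    using that
  proof (induction m)
    case (Suc m)
    have m: "\<xi> m \<le> \<xi> (Suc m)" using is_partition_mono[OF p, of m "Suc m"] Suc.prems by simp
    have "((\<lambda>_. z m) has_integral (\<xi> (Suc m) - \<xi> m) *\<^sub>R z m) (cbox (\<xi> m) (\<xi> (Suc m)))"
      using has_integral_const_real[of "z m" "\<xi> m" "\<xi> (Suc m)"] m by simp
    then have "(chain_fun n \<xi> z has_integral (\<xi> (Suc m) - \<xi> m) *\<^sub>R z m) (cbox (\<xi> m) (\<xi> (Suc m)))"
      using Suc.prems by (elim has_integral_spike_interior) (simp add: chain_fun_eq part_index_eq[OF p, of m])
    then show ?case
      using has_integral_combine[OF is_partition_mono[OF p, of 0 m] m Suc.IH] Suc.prems by simp
  qed (simp add: has_integral_refl)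
  from this[of n] show ?thesis using is_partitionD(1,2)[OF p] by simp
qed

text \<open>Any partition of the shorter interval is prolonged by the single point \<open>d\<close>.
  Rearranged, this bounds the Hausdorff distance of two values by an increment of the variation
  function.\<close>

lemma variation_extend:
  assumes "a \<le> c" "c < d"
  shows "variation N a c F + haus N (F d) (F c) \<le> variation N a d F"
proof -
  let ?P = "\<lambda>c. {(n, \<xi>). is_partition a c n \<xi>}"
  \<comment> \<open>The added distance can be moved into the supremum only if there is some
    partition; for a = c it is the one with n = 0.\<close>
  have "?P c \<noteq> {}"
  proof (cases "a = c")
    case True
    then have "(0, \<lambda>_. a) \<in> ?P c" by (simp add: is_partition_def)
    then show ?thesis by blast
  next
    case False
    then have "(1, \<lambda>i. if i = 0 then a else c) \<in> ?P c" using assms by (simp add: is_partition_def)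
    then show ?thesis by blast
  qed
  then have "variation N a c F + haus N (F d) (F c) =
    (SUP p\<in>?P c. (case p of (n, \<xi>) \<Rightarrow> \<Sum>i<n. haus N (F (\<xi> (Suc i))) (F (\<xi> i))) + haus N (F d) (F c))"
    unfolding variation_def by (subst ennreal_SUP_add_left) auto
  also have "\<dots> \<le> variation N a d F"
  proof (rule SUP_least, clarify)
    fix n \<xi> assume p: "is_partition a c n \<xi>"
    define \<xi>' where "\<xi>' = \<xi>(Suc n := d)"
    have "is_partition a d (Suc n) \<xi>'"
      using assms is_partitionD[OF p] unfolding is_partition_def \<xi>'_def by (simp add: less_Suc_eq)
    then have "(\<Sum>i<Suc n. haus N (F (\<xi>' (Suc i))) (F (\<xi>' i))) \<le> variation N a d F"
      unfolding variation_def by (intro SUP_upper2[of "(Suc n, \<xi>')"]) auto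
    moreover have "(\<Sum>i<n. haus N (F (\<xi>' (Suc i))) (F (\<xi>' i))) = (\<Sum>i<n. haus N (F (\<xi> (Suc i))) (F (\<xi> i)))"
      by (intro sum.cong) (auto simp: \<xi>'_def)
    ultimately show "(\<Sum>i<n. haus N (F (\<xi> (Suc i))) (F (\<xi> i))) + haus N (F d) (F c) \<le> variation N a d F"
      using is_partitionD(2)[OF p] by (simp add: \<xi>'_def)
  qed
  finally show ?thesis .
qed

section \<open>Metric selections and metric integrals\<close>

locale BV_multifunction =
  fixes N :: "real ^ 'd \<Rightarrow> real" and a b :: real and F :: "real \<Rightarrow> (real ^ 'd) set"
  assumes N: "is_norm N" and ab: "a < b" and F: "F \<in> BV_compact_graph N a b"
begin

section \<open>The variation function and its control of metric chains\<close>

abbreviation v :: "real \<Rightarrow> real" where "v \<equiv> variation_fun N a F"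

lemma F_compact: "x \<in> {a..b} \<Longrightarrow> compact (F x)" "x \<in> {a..b} \<Longrightarrow> F x \<noteq> {}"
  and F_graph: "compact {(x, y). x \<in> {a..b} \<and> y \<in> F x}"
  and F_variation: "variation N a b F < \<infinity>"
  using F unfolding BV_compact_graph_def by blast+

lemma variation_mono:
  assumes "a \<le> c" "c \<le> d"
  shows "variation N a c F \<le> variation N a d F"
proof (cases "c = d")
  case False
  then have "variation N a c F + haus N (F d) (F c) \<le> variation N a d F"
    using assms by (intro variation_extend) auto
  then show ?thesis by (rule order_trans[rotated]) simp
qed simp

lemma variation_eq_v:
  assumes "a \<le> c" "c \<le> b"
  shows "variation N a c F = ennreal (v c)"
  using variation_mono[OF assms] F_variation by (simp add: variation_fun_def)

lemma v_nonneg: "0 \<le> v c"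
  by (simp add: variation_fun_def)

text \<open>To the left of \<open>a\<close> there are no partitions and the supremum is over the
  empty set. This default value makes \<open>v\<close> monotone on the whole half-line up to
  \<open>b\<close>, so left limits can be treated uniformly even at \<open>a\<close>.\<close>

lemma v_outside:
  assumes "c < a"
  shows "v c = 0"
proof -
  have "\<not> is_partition a c n \<xi>" for n \<xi>
    using is_partition_range[of a c n \<xi> 0] assms by auto
  then show ?thesis by (simp add: variation_fun_def variation_def bot_ennreal)
qed

lemma v_mono:
  assumes "c \<le> d" "d \<le> b"
  shows "v c \<le> v d"
proof (cases "a \<le> c")
  case True
  then show ?thesis
    using variation_mono[OF True assms(1)] assms by (simp add: variation_eq_v v_nonneg)
qed (simp add: v_outside v_nonneg)

lemma haus_le_v:
  assumes "a \<le> c" "c < d" "d \<le> b"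
  shows "haus N (F c) (F d) \<le> ennreal (v d - v c)"
proof -
  have le: "ennreal (v c) + haus N (F d) (F c) \<le> ennreal (v d)"
    using variation_extend[OF assms(1,2), of N F] assms by (simp add: variation_eq_v)
  show ?thesis
  proof (cases "haus N (F d) (F c)")
    case (real h)
    then have "v c + h \<le> v d"
      using le v_nonneg by (simp flip: ennreal_plus)
    then show ?thesis
      using real by (simp add: haus_commute[of N "F c"] ennreal_leI)
  next
    case top
    then show ?thesis using le by (simp add: top_unique)
  qed
qed

lemma chain_control:
  assumes p: "is_partition a b n \<xi>" and y: "y \<in> metric_chains N n (\<lambda>i. F (\<xi> i))"
    and "i \<le> j" "j \<le> n"
  shows "N (y i - y j) \<le> v (\<xi> j) - v (\<xi> i)"
  using assms(3,4)
proof (induction j rule: dec_induct)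
  case (step j)
  have j: "j < n" "\<xi> j \<in> {a..b}" "\<xi> (Suc j) \<in> {a..b}" "\<xi> j < \<xi> (Suc j)"
    using step is_partition_range[OF p] is_partitionD(3)[OF p] by simp_all
  then have "(y j, y (Suc j)) \<in> metric_pairs N (F (\<xi> j)) (F (\<xi> (Suc j)))"
    using y unfolding metric_chains_def by blast
  then have "ennreal (N (y j - y (Suc j))) \<le> ennreal (v (\<xi> (Suc j)) - v (\<xi> j))"
    using haus_le_v[of "\<xi> j" "\<xi> (Suc j)"] metric_pair_le_haus j order_trans by fastforce
  then have "N (y j - y (Suc j)) \<le> v (\<xi> (Suc j)) - v (\<xi> j)"
    using v_mono[of "\<xi> j" "\<xi> (Suc j)"] j by (simp add: ennreal_le_iff)
  then show ?case
    using is_normD(8)[OF N, of "y i" "y (Suc j)" "y j"] step by simp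
qed (simp add: is_normD(2)[OF N])

text \<open>The partition points lie to the left of the arguments. For \<open>u\<close> this is
  harmless, as \<open>v\<close> may be increased to \<open>v u\<close>; for \<open>t\<close> the
  smaller value has to stay, and it becomes a left limit when the mesh tends to 0.\<close>

lemma chain_fun_control:
  assumes p: "is_partition a b n \<xi>" and y: "y \<in> metric_chains N n (\<lambda>i. F (\<xi> i))"
    and tu: "a \<le> t" "t \<le> u" "u \<le> b"
  shows "N (chain_fun n \<xi> y t - chain_fun n \<xi> y u) \<le> v u - v (\<xi> (part_index n \<xi> t))"
proof -
  have "N (chain_fun n \<xi> y t - chain_fun n \<xi> y u) \<le> v (\<xi> (part_index n \<xi> u)) - v (\<xi> (part_index n \<xi> t))"
    unfolding chain_fun_eq using tu
    by (intro chain_control[OF p y] part_index_mono[OF p] part_index_le[OF p]) auto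
  moreover have "v (\<xi> (part_index n \<xi> u)) \<le> v u"
    using tu by (intro v_mono part_index_le[OF p]) auto
  ultimately show ?thesis by simp
qed

lemma chain_fun_mem:
  assumes p: "is_partition a b n \<xi>" and y: "y \<in> metric_chains N n (\<lambda>i. F (\<xi> i))" and t: "t \<in> {a..b}"
  shows "chain_fun n \<xi> y t \<in> F (\<xi> (part_index n \<xi> t))"
proof -
  have "\<forall>i\<le>n. y i \<in> F (\<xi> i)" using y unfolding metric_chains_def by blast
  then show ?thesis using part_index_le(1)[OF p t] unfolding chain_fun_eq by blast
qed

section \<open>Limits of chain functions and of weighted Riemann sums\<close>

lemma F_bounded: obtains B where "\<And>x y. x \<in> {a..b} \<Longrightarrow> y \<in> F x \<Longrightarrow> norm y \<le> B"
proof -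
  define G where "G = {(x, y). x \<in> {a..b} \<and> y \<in> F x}"
  have "bounded G" unfolding G_def by (rule compact_imp_bounded[OF F_graph])
  then obtain B where B: "\<forall>p\<in>G. norm p \<le> B" unfolding bounded_iff ..
  have "norm y \<le> B" if "x \<in> {a..b}" "y \<in> F x" for x y
  proof -
    have "norm (x, y) \<le> B" using B that by (simp add: G_def)
    then show ?thesis using norm_snd_le[of y x] by simp
  qed
  then show thesis using that by blast
qed

text \<open>The partition points below \<open>t\<close> converge to \<open>t\<close> and finally
  exceed any fixed t' < t. Quantifying over \<open>t'\<close> expresses the left limit of
  \<open>v\<close> without introducing it; \<open>t'\<close> may lie to the left of
  \<open>a\<close>.\<close>

lemma metric_selection_control:
  assumes s: "s \<in> metric_selections N a b F" and tu: "a \<le> t" "t \<le> u" "u \<le> b" and "t' < t"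
  shows "N (s t - s u) \<le> v u - v t'"
proof -
  from s obtain n \<xi> \<phi> where p: "\<And>k. is_partition a b (n k) (\<xi> k)"
    and ch: "\<And>k. \<phi> k \<in> metric_chains N (n k) (\<lambda>i. F (\<xi> k i))"
    and mesh: "(\<lambda>k. mesh (n k) (\<xi> k)) \<longlonglongrightarrow> 0"
    and lim: "\<And>x. x \<in> {a..b} \<Longrightarrow> (\<lambda>k. chain_fun (n k) (\<xi> k) (\<phi> k) x) \<longlonglongrightarrow> s x"
    unfolding metric_selections_def by blast
  have "(\<lambda>k. N (chain_fun (n k) (\<xi> k) (\<phi> k) t - chain_fun (n k) (\<xi> k) (\<phi> k) u)) \<longlonglongrightarrow> N (s t - s u)"
    using tu by (intro is_norm_tendsto[OF N] tendsto_diff lim) auto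
  moreover have "\<forall>\<^sub>F k in sequentially.
      N (chain_fun (n k) (\<xi> k) (\<phi> k) t - chain_fun (n k) (\<xi> k) (\<phi> k) u) \<le> v u - v t'"
  proof -
    have "\<forall>\<^sub>F k in sequentially. t' < \<xi> k (part_index (n k) (\<xi> k) t)"
      using part_point_tendsto[OF p ab mesh, of t] tu assms(5) by (intro order_tendstoD(1)) auto
    then show ?thesis
    proof eventually_elim
      case (elim k)
      have "v t' \<le> v (\<xi> k (part_index (n k) (\<xi> k) t))"
        using elim part_index_le(2)[OF p, of t k] tu by (intro v_mono) auto
      then show ?case using chain_fun_control[OF p ch tu, of k] by simp
    qed
  qed
  ultimately show ?thesis
    by (rule tendsto_upperbound) simp
qed

text \<open>A weighted Riemann sum is the exact integral of the step function with values
  \<open>\<kappa> (\<xi> k i) *\<^sub>R \<phi> k i\<close>. These step functions are uniformly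
  bounded and converge pointwise, so dominated convergence yields the limit together with its
  integrability.\<close>

lemma weighted_sum_tendsto_integral:
  assumes \<kappa>: "continuous_on {a..b} \<kappa>"
    and p: "\<And>k. is_partition a b (n k) (\<xi> k)"
    and ch: "\<And>k. \<phi> k \<in> metric_chains N (n k) (\<lambda>i. F (\<xi> k i))"
    and mesh: "(\<lambda>k. mesh (n k) (\<xi> k)) \<longlonglongrightarrow> 0"
    and lim: "\<And>x. x \<in> {a..b} \<Longrightarrow> (\<lambda>k. chain_fun (n k) (\<xi> k) (\<phi> k) x) \<longlonglongrightarrow> s x"
  shows "(\<lambda>t. \<kappa> t *\<^sub>R s t) integrable_on {a..b}"
    and "(\<lambda>k. \<Sum>i<n k. ((\<xi> k (Suc i) - \<xi> k i) * \<kappa> (\<xi> k i)) *\<^sub>R \<phi> k i)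
      \<longlonglongrightarrow> integral {a..b} (\<lambda>t. \<kappa> t *\<^sub>R s t)"
proof -
  define f where "f = (\<lambda>k. chain_fun (n k) (\<xi> k) (\<lambda>i. \<kappa> (\<xi> k i) *\<^sub>R \<phi> k i))"
  have f_int: "(f k has_integral (\<Sum>i<n k. ((\<xi> k (Suc i) - \<xi> k i) * \<kappa> (\<xi> k i)) *\<^sub>R \<phi> k i)) {a..b}" for k
    using chain_fun_has_integral[OF p, of k "\<lambda>i. \<kappa> (\<xi> k i) *\<^sub>R \<phi> k i"] by (simp add: f_def)
  obtain B where B: "\<And>x y. x \<in> {a..b} \<Longrightarrow> y \<in> F x \<Longrightarrow> norm y \<le> B"
    using F_bounded by blast
  obtain K where K: "\<And>t. t \<in> {a..b} \<Longrightarrow> norm (\<kappa> t) \<le> K"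
    using compact_imp_bounded[OF compact_continuous_image[OF \<kappa> compact_Icc]] unfolding bounded_iff by blast
  have f_eq: "f k t = \<kappa> (\<xi> k (part_index (n k) (\<xi> k) t)) *\<^sub>R chain_fun (n k) (\<xi> k) (\<phi> k) t" for k t
    by (simp add: f_def chain_fun_eq)
  have pt: "\<xi> k (part_index (n k) (\<xi> k) t) \<in> {a..b}" if "t \<in> {a..b}" for k t
    using part_index_le(1)[OF p that] is_partition_range[OF p] by blast
  have bnd: "norm (f k t) \<le> K * B" if "t \<in> {a..b}" for k t
    unfolding f_eq norm_scaleR
    using K[OF pt[OF that]] B[OF pt[OF that] chain_fun_mem[OF p ch that]] K[of a] ab
    by (intro mult_mono) auto
  have conv: "(\<lambda>k. f k t) \<longlonglongrightarrow> \<kappa> t *\<^sub>R s t" if "t \<in> {a..b}" for t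
  proof -
    have "(\<lambda>k. \<kappa> (\<xi> k (part_index (n k) (\<xi> k) t))) \<longlonglongrightarrow> \<kappa> t"
      using pt[OF that] that
      by (intro continuous_on_tendsto_compose[OF \<kappa> part_point_tendsto[OF p ab mesh that]]) auto
    then show ?thesis
      unfolding f_eq by (intro tendsto_scaleR lim that)
  qed
  note dc = dominated_convergence[OF has_integral_integrable[OF f_int] integrable_const_ivl bnd conv]
  show "(\<lambda>t. \<kappa> t *\<^sub>R s t) integrable_on {a..b}" by (rule dc(1))
  show "(\<lambda>k. \<Sum>i<n k. ((\<xi> k (Suc i) - \<xi> k i) * \<kappa> (\<xi> k i)) *\<^sub>R \<phi> k i)
      \<longlonglongrightarrow> integral {a..b} (\<lambda>t. \<kappa> t *\<^sub>R s t)"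
    using dc(2) by (simp add: integral_unique[OF f_int])
qed

text \<open>
  Every chain function is controlled by the single monotone function \<^term>\<open>v\<close>, so convergence on a
  countable dense set containing the discontinuities of \<^term>\<open>v\<close> propagates to all points.
\<close>

lemma chain_functions_subsequence:
  assumes p: "\<And>k. is_partition a b (n k) (\<xi> k)"
    and ch: "\<And>k. \<phi> k \<in> metric_chains N (n k) (\<lambda>i. F (\<xi> k i))"
    and mesh: "(\<lambda>k. mesh (n k) (\<xi> k)) \<longlonglongrightarrow> 0"
  obtains r s where "strict_mono r" "s \<in> metric_selections N a b F"
    "\<And>x. x \<in> {a..b} \<Longrightarrow> (\<lambda>k. chain_fun (n (r k)) (\<xi> (r k)) (\<phi> (r k)) x) \<longlonglongrightarrow> s x"
proof -
  define c where "c = (\<lambda>k. chain_fun (n k) (\<xi> k) (\<phi> k))"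
  define \<tau> where "\<tau> = (\<lambda>k t. \<xi> k (part_index (n k) (\<xi> k) t))"
  \<comment> \<open>With the endpoints in \<open>S\<close>, every remaining \<open>t\<close> is a
    continuity point of \<open>v\<close> with rationals of \<open>S\<close> immediately to its
    right.\<close>
  define S where "S = {a..b} \<inter> (\<rat> \<union> {a, b} \<union> {t \<in> {a..b}. \<not> continuous (at t within {a..b}) v})"
  have "mono_on {a..b} v"
    by (intro mono_onI v_mono) auto
  then have "countable S"
    unfolding S_def by (intro countable_Int2 countable_Un countable_rat mono_on_ctble_discont) auto
  obtain B where B: "\<And>x y. x \<in> {a..b} \<Longrightarrow> y \<in> F x \<Longrightarrow> norm y \<le> B"
    using F_bounded by blast
  have pt: "\<tau> k t \<in> {a..b}" if "t \<in> {a..b}" for k t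
    unfolding \<tau>_def using part_index_le(1)[OF p that] is_partition_range[OF p] by blast
  have c_mem: "c k t \<in> F (\<tau> k t)" if "t \<in> {a..b}" for k t
    unfolding c_def \<tau>_def by (rule chain_fun_mem[OF p ch that])
  have "norm (c k t) \<le> B" if "t \<in> S" for k t
    using that B[OF pt c_mem] by (auto simp: S_def)
  \<comment> \<open>Diagonal argument: one subsequence converges at all points of the countable
    set.\<close>
  then obtain r where r: "strict_mono r" and r_conv: "\<And>t. t \<in> S \<Longrightarrow> \<exists>l. (\<lambda>k. c (r k) t) \<longlonglongrightarrow> l"
    using function_convergent_subsequence[OF \<open>countable S\<close>, of c B] by metis
  have \<tau>_lim: "(\<lambda>k. \<tau> (r k) t) \<longlonglongrightarrow> t" if "t \<in> {a..b}" for t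
    using LIMSEQ_subseq_LIMSEQ[OF part_point_tendsto[OF p ab mesh that] r] by (simp add: \<tau>_def o_def)
  obtain C where C: "C > 0" "\<And>z. norm z \<le> C * N z"
    using is_norm_dominates_norm[OF N] by blast
  have "\<exists>l. (\<lambda>k. c (r k) t) \<longlonglongrightarrow> l" if t: "t \<in> {a..b}" for t
  proof (cases "t \<in> S")
    case False
    with t have "a < t" "t < b" and cont: "continuous (at t within {a..b}) v" by (auto simp: S_def)
    have "Cauchy (\<lambda>k. c (r k) t)"
    proof (rule metric_CauchyI)
      fix e :: real assume "e > 0"
      \<comment> \<open>Both \<open>q\<close> and the partition point deviate from \<open>t\<close>
        by at most e' in terms of \<open>v\<close>, and C * 2 * e' = e / 3.\<close>
      define e' where "e' = e / (6 * C)"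
      have "e' > 0" using \<open>e > 0\<close> C by (simp add: e'_def)
      then obtain d where d: "d > 0" "\<And>z. z \<in> {a..b} \<Longrightarrow> dist z t < d \<Longrightarrow> dist (v z) (v t) < e'"
        using cont unfolding continuous_within_eps_delta by metis
      obtain q where q: "q \<in> \<rat>" "t < q" "q < min (t + d) b"
        using Rats_dense_in_real[of t "min (t + d) b"] d \<open>t < b\<close> by auto
      then have qS: "q \<in> S" and qab: "q \<in> {a..b}" using t by (auto simp: S_def)
      then have "Cauchy (\<lambda>k. c (r k) q)" using r_conv LIMSEQ_imp_Cauchy by blast
      then obtain M1 where M1: "\<And>i j. i \<ge> M1 \<Longrightarrow> j \<ge> M1 \<Longrightarrow> dist (c (r i) q) (c (r j) q) < e / 3"
        using \<open>e > 0\<close> unfolding Cauchy_def by (metis divide_pos_pos zero_less_numeral)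
      obtain M2 where M2: "\<And>k. k \<ge> M2 \<Longrightarrow> dist (\<tau> (r k) t) t < d"
        using \<tau>_lim[OF t] d(1) unfolding lim_sequentially by blast
      have close: "dist (c (r k) t) (c (r k) q) < e / 3" if "k \<ge> M2" for k
      proof -
        have "dist (v q) (v t) < e'" "dist (v (\<tau> (r k) t)) (v t) < e'"
          using d(2)[OF qab] q d(2)[OF pt[OF t] M2[OF that]] by (auto simp: dist_real_def)
        then have "v q - v (\<tau> (r k) t) < 2 * e'" by (simp add: dist_real_def)
        moreover have "N (c (r k) t - c (r k) q) \<le> v q - v (\<tau> (r k) t)"
          unfolding c_def \<tau>_def using t q qab by (intro chain_fun_control[OF p ch]) auto
        ultimately have "C * N (c (r k) t - c (r k) q) < C * (2 * e')"
          using C(1) by (intro mult_strict_left_mono) auto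
        then show ?thesis
          using C(2)[of "c (r k) t - c (r k) q"] C(1) by (simp add: dist_norm e'_def)
      qed
      show "\<exists>M. \<forall>i\<ge>M. \<forall>j\<ge>M. dist (c (r i) t) (c (r j) t) < e"
      proof (intro exI[of _ "max M1 M2"] allI impI)
        fix i j assume "i \<ge> max M1 M2" "j \<ge> max M1 M2"
        then have "dist (c (r i) t) (c (r i) q) < e / 3" "dist (c (r j) t) (c (r j) q) < e / 3"
          "dist (c (r i) q) (c (r j) q) < e / 3"
          using close M1 by auto
        then show "dist (c (r i) t) (c (r j) t) < e"
          by metric
      qed
    qed
    then show ?thesis by (simp add: Cauchy_convergent_iff convergent_def)
  qed (use r_conv in blast)
  then obtain s where s: "\<And>t. t \<in> {a..b} \<Longrightarrow> (\<lambda>k. c (r k) t) \<longlonglongrightarrow> s t"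
    by metis
  \<comment> \<open>The chain values lie in \<open>F\<close> at nearby partition points, not at
    \<open>t\<close>; closedness of the graph transfers membership to the limit.\<close>
  have "s t \<in> F t" if t: "t \<in> {a..b}" for t
  proof -
    have lim: "(\<lambda>k. (\<tau> (r k) t, c (r k) t)) \<longlonglongrightarrow> (t, s t)"
      by (intro tendsto_Pair \<tau>_lim s t)
    have mem: "(\<tau> (r k) t, c (r k) t) \<in> {(x, y). x \<in> {a..b} \<and> y \<in> F x}" for k
      using pt[OF t] c_mem[OF t] by simp
    have "(t, s t) \<in> {(x, y). x \<in> {a..b} \<and> y \<in> F x}"
      by (rule closed_sequentially[OF compact_imp_closed[OF F_graph] mem lim])
    then show ?thesis by simp
  qed
  moreover have "(\<lambda>k. mesh (n (r k)) (\<xi> (r k))) \<longlonglongrightarrow> 0"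
    using LIMSEQ_subseq_LIMSEQ[OF mesh r] by (simp add: o_def)
  ultimately have "s \<in> metric_selections N a b F"
    unfolding metric_selections_def using p ch s
    by (intro CollectI conjI exI[of _ "\<lambda>k. n (r k)"] exI[of _ "\<lambda>k. \<xi> (r k)"] exI[of _ "\<lambda>k. \<phi> (r k)"])
       (simp_all add: c_def)
  with r s show thesis by (intro that) (auto simp: c_def)
qed

text \<open>Riemann sums use chains that stop before the last partition point, whereas selections
  use full chains. The mismatch is repaired by appending a nearest point or by dropping the last
  element, neither of which changes the sum.\<close>

lemma weighted_metric_integral_eq:
  assumes \<kappa>: "continuous_on {a..b} \<kappa>"
  shows "weighted_metric_integral N \<kappa> a b F
    = (\<lambda>s. integral {a..b} (\<lambda>t. \<kappa> t *\<^sub>R s t)) ` metric_selections N a b F"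
proof (intro equalityI subsetI)
  fix w assume "w \<in> weighted_metric_integral N \<kappa> a b F"
  then obtain n \<xi> z where p: "\<And>k. is_partition a b (n k) (\<xi> k)"
    and z: "\<And>k. z k \<in> metric_riemann_sums N \<kappa> (n k) (\<xi> k) F"
    and mesh: "(\<lambda>k. mesh (n k) (\<xi> k)) \<longlonglongrightarrow> 0" and w: "z \<longlonglongrightarrow> w"
    unfolding weighted_metric_integral_def by blast
  have "\<exists>y. y \<in> metric_chains N (n k) (\<lambda>i. F (\<xi> k i)) \<and>
      z k = (\<Sum>i<n k. ((\<xi> k (Suc i) - \<xi> k i) * \<kappa> (\<xi> k i)) *\<^sub>R y i)" for k
  proof -
    obtain y where y: "y \<in> metric_chains N (n k - 1) (\<lambda>i. F (\<xi> k i))"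
      "z k = (\<Sum>i<n k. ((\<xi> k (Suc i) - \<xi> k i) * \<kappa> (\<xi> k i)) *\<^sub>R y i)"
      using z[of k] unfolding metric_riemann_sums_def by blast
    have "n k \<noteq> 0" using is_partitionD(1,2)[OF p[of k]] ab by (intro notI) simp
    then obtain m where m: "n k = Suc m" using not0_implies_Suc by blast
    obtain e where e: "(y m, e) \<in> metric_pairs N (F (\<xi> k m)) (F (\<xi> k (Suc m)))"
      using metric_pair_exists[OF N, of "y m" "F (\<xi> k m)" "F (\<xi> k (Suc m))"] y(1) F_compact
        is_partition_range[OF p[of k], of "Suc m"] m by (auto simp: metric_chains_def)
    have ext: "y(Suc m := e) \<in> metric_chains N (n k) (\<lambda>i. F (\<xi> k i))"
      using y(1) e m by (auto simp: metric_chains_def metric_pairs_def less_Suc_eq le_Suc_eq)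
    have "z k = (\<Sum>i<n k. ((\<xi> k (Suc i) - \<xi> k i) * \<kappa> (\<xi> k i)) *\<^sub>R (y(Suc m := e)) i)"
      unfolding y(2) m by (intro sum.cong) auto
    with ext show ?thesis by (intro exI[of _ "y(Suc m := e)"] conjI)
  qed
  then obtain \<phi> where \<phi>: "\<And>k. \<phi> k \<in> metric_chains N (n k) (\<lambda>i. F (\<xi> k i))"
    "\<And>k. z k = (\<Sum>i<n k. ((\<xi> k (Suc i) - \<xi> k i) * \<kappa> (\<xi> k i)) *\<^sub>R \<phi> k i)"
    by metis
  obtain r s where r: "strict_mono r" and s: "s \<in> metric_selections N a b F"
    and lim: "\<And>x. x \<in> {a..b} \<Longrightarrow> (\<lambda>k. chain_fun (n (r k)) (\<xi> (r k)) (\<phi> (r k)) x) \<longlonglongrightarrow> s x"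
    using chain_functions_subsequence[OF p \<phi>(1) mesh] by blast
  have "(\<lambda>k. z (r k)) \<longlonglongrightarrow> integral {a..b} (\<lambda>t. \<kappa> t *\<^sub>R s t)"
    unfolding \<phi>(2) using LIMSEQ_subseq_LIMSEQ[OF mesh r]
    by (intro weighted_sum_tendsto_integral[OF \<kappa> p \<phi>(1) _ lim]) (simp add: o_def)
  moreover have "(\<lambda>k. z (r k)) \<longlonglongrightarrow> w"
    using LIMSEQ_subseq_LIMSEQ[OF w r] by (simp add: o_def)
  ultimately show "w \<in> (\<lambda>s. integral {a..b} (\<lambda>t. \<kappa> t *\<^sub>R s t)) ` metric_selections N a b F"
    using s LIMSEQ_unique by blast
next
  fix w assume "w \<in> (\<lambda>s. integral {a..b} (\<lambda>t. \<kappa> t *\<^sub>R s t)) ` metric_selections N a b F"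
  then obtain s n \<xi> \<phi> where w: "w = integral {a..b} (\<lambda>t. \<kappa> t *\<^sub>R s t)"
    and p: "\<And>k. is_partition a b (n k) (\<xi> k)"
    and ch: "\<And>k. \<phi> k \<in> metric_chains N (n k) (\<lambda>i. F (\<xi> k i))"
    and mesh: "(\<lambda>k. mesh (n k) (\<xi> k)) \<longlonglongrightarrow> 0"
    and lim: "\<And>x. x \<in> {a..b} \<Longrightarrow> (\<lambda>k. chain_fun (n k) (\<xi> k) (\<phi> k) x) \<longlonglongrightarrow> s x"
    unfolding metric_selections_def by blast
  have "\<phi> k \<in> metric_chains N (n k - 1) (\<lambda>i. F (\<xi> k i))" for k
    using ch[of k] by (auto simp: metric_chains_def)
  then have "(\<Sum>i<n k. ((\<xi> k (Suc i) - \<xi> k i) * \<kappa> (\<xi> k i)) *\<^sub>R \<phi> k i) \<in> metric_riemann_sums N \<kappa> (n k) (\<xi> k) F" for k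
    unfolding metric_riemann_sums_def by blast
  moreover have "(\<lambda>k. \<Sum>i<n k. ((\<xi> k (Suc i) - \<xi> k i) * \<kappa> (\<xi> k i)) *\<^sub>R \<phi> k i) \<longlonglongrightarrow> w"
    unfolding w by (rule weighted_sum_tendsto_integral(2)[OF \<kappa> p ch mesh lim])
  ultimately show "w \<in> weighted_metric_integral N \<kappa> a b F"
    unfolding weighted_metric_integral_def using p mesh
    by (intro CollectI exI conjI allI) assumption+
qed

lemma weighted_selection_integrable:
  assumes \<kappa>: "continuous_on {a..b} \<kappa>" and "s \<in> metric_selections N a b F"
  shows "(\<lambda>t. \<kappa> t *\<^sub>R s t) integrable_on {a..b}"
proof -
  from assms(2) obtain n \<xi> \<phi> where p: "\<And>k. is_partition a b (n k) (\<xi> k)"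
    and ch: "\<And>k. \<phi> k \<in> metric_chains N (n k) (\<lambda>i. F (\<xi> k i))"
    and mesh: "(\<lambda>k. mesh (n k) (\<xi> k)) \<longlonglongrightarrow> 0"
    and lim: "\<And>x. x \<in> {a..b} \<Longrightarrow> (\<lambda>k. chain_fun (n k) (\<xi> k) (\<phi> k) x) \<longlonglongrightarrow> s x"
    unfolding metric_selections_def by blast
  show ?thesis
    by (rule weighted_sum_tendsto_integral(1)[OF \<kappa> p ch mesh lim])
qed

text \<open>The left limit of the monotone function \<open>v\<close>, in a form that also makes
  sense at \<open>a\<close>: there it is 0 because \<open>v\<close> vanishes further left.\<close>

definition v_left :: "real \<Rightarrow> real" where "v_left t = Sup (v ` {..<t})"

lemma v_le_v_left:
  assumes "t' < t" "t \<le> b"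
  shows "v t' \<le> v_left t"
  unfolding v_left_def using assms v_mono[of _ t]
  by (intro cSup_upper) (auto intro!: bdd_aboveI[of _ "v t"])

lemma v_left_le:
  assumes "\<And>t'. t' < t \<Longrightarrow> v t' \<le> r"
  shows "v_left t \<le> r"
  unfolding v_left_def using assms lt_ex[of t] by (intro cSup_least) auto

lemma v_left_le_v: "t \<le> b \<Longrightarrow> v_left t \<le> v t"
  by (intro v_left_le v_mono) auto

text \<open>
  A single monotone control valid at both arguments: \<^term>\<open>v\<close> alone would miss the jump of a
  selection at its left argument.
\<close>

lemma metric_selection_control_sum:
  assumes s: "s \<in> metric_selections N a b F" and tu: "a \<le> t" "t \<le> u" "u \<le> b"
  shows "N (s t - s u) \<le> (v u + v_left u) - (v t + v_left t)"
proof (cases "t = u")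
  case False
  have "v_left t \<le> v u - N (s t - s u)"
    using metric_selection_control[OF s tu] by (intro v_left_le) (simp add: algebra_simps)
  moreover have "v t \<le> v_left u"
    using False tu by (intro v_le_v_left) auto
  ultimately show ?thesis by simp
qed (simp add: is_normD(2)[OF N])

section \<open>One-sided limits of the variation function and quasi-moduli\<close>

lemma v_one_sided_limits:
  assumes x: "a < x" "x < b"
  obtains vl vr where "(v \<longlongrightarrow> vl) (at_left x)" "(v \<longlongrightarrow> vr) (at_right x)"
    "\<And>t. a \<le> t \<Longrightarrow> t < x \<Longrightarrow> v t \<le> vl" "\<And>t. x < t \<Longrightarrow> t \<le> b \<Longrightarrow> vr \<le> v t"
proof -
  obtain vl vr where lim: "(v \<longlongrightarrow> vl) (at_left x)" "(v \<longlongrightarrow> vr) (at_right x)"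
    using mono_one_sided_limits[OF x, of v, OF v_mono] by blast
  have "v t \<le> vl" if "a \<le> t" "t < x" for t
    by (rule tendsto_lowerbound[OF lim(1)])
      (use that x in \<open>auto simp: eventually_at_left_field intro!: exI[of _ t] v_mono\<close>)
  moreover have "vr \<le> v t" if "x < t" "t \<le> b" for t
    by (rule tendsto_upperbound[OF lim(2)])
      (use that x in \<open>auto simp: eventually_at_right_field intro!: exI[of _ t] v_mono\<close>)
  ultimately show thesis using that lim by blast
qed

lemma left_quasi_modulus_ge:
  assumes "(v \<longlongrightarrow> vl) (at_left x)" "x \<le> b" "0 < \<delta>" "a \<le> x - \<delta>"
  shows "vl - v (x - \<delta>) \<le> left_quasi_modulus a b v x \<delta>"
proof -
  have "Lim (at_left x) v = vl" using assms(1) by (intro tendsto_Lim) auto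
  moreover have "\<bar>vl - v (x - \<delta>)\<bar> \<le> (SUP t\<in>{x - \<delta>..<x} \<inter> {a..b}. \<bar>vl - v t\<bar>)"
  proof (rule cSUP_upper)
    \<comment> \<open>A supremum of reals dominates its terms only if the family is bounded
      above.\<close>
    have "\<bar>vl - v t\<bar> \<le> \<bar>vl\<bar> + v b" if "t \<le> b" for t
      using v_mono[OF that] v_nonneg[of t] by linarith
    then show "bdd_above ((\<lambda>t. \<bar>vl - v t\<bar>) ` ({x - \<delta>..<x} \<inter> {a..b}))"
      by (intro bdd_aboveI[of _ "\<bar>vl\<bar> + v b"]) auto
  qed (use assms in auto)
  ultimately show ?thesis unfolding left_quasi_modulus_def by simp
qed

lemma right_quasi_modulus_ge:
  assumes "(v \<longlongrightarrow> vr) (at_right x)" "a \<le> x" "0 < \<delta>" "x + \<delta> \<le> b"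
  shows "v (x + \<delta>) - vr \<le> right_quasi_modulus a b v x \<delta>"
proof -
  have "Lim (at_right x) v = vr" using assms(1) by (intro tendsto_Lim) auto
  moreover have "\<bar>vr - v (x + \<delta>)\<bar> \<le> (SUP t\<in>{x<..x + \<delta>} \<inter> {a..b}. \<bar>vr - v t\<bar>)"
  proof (rule cSUP_upper)
    have "\<bar>vr - v t\<bar> \<le> \<bar>vr\<bar> + v b" if "t \<le> b" for t
      using v_mono[OF that] v_nonneg[of t] by linarith
    then show "bdd_above ((\<lambda>t. \<bar>vr - v t\<bar>) ` ({x<..x + \<delta>} \<inter> {a..b}))"
      by (intro bdd_aboveI[of _ "\<bar>vr\<bar> + v b"]) auto
  qed (use assms in auto)
  ultimately show ?thesis unfolding right_quasi_modulus_def by simp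
qed

end

section \<open>Metric Fourier series\<close>

lemma continuous_on_dirichlet_kernel: "continuous_on S (\<lambda>t. dirichlet_kernel n (x - t))"
  unfolding dirichlet_kernel_def by (intro continuous_intros)

text \<open>The scalar estimate is applied to the components of \<open>s\<close>. Since the control
  is made of two copies of the variation function, its one-sided increments near \<open>x\<close>
  are at most \<open>2 * C * \<omega>\<close> each, so 208 = 52 * 4. The remaining factors come from
  comparing \<open>N\<close> with the Euclidean norm and with the sum of the components.\<close>

lemma selection_fourier_bound:
  fixes N :: "real ^ 'd \<Rightarrow> real"
  assumes N: "is_norm N" and F: "F \<in> BV_compact_graph N (- pi) pi"
    and C: "C > 0" "\<And>z. norm z \<le> C * N z"
    and C': "C' > 0" "\<And>z. N z \<le> C' * (\<Sum>j\<in>UNIV. \<bar>z $ j\<bar>)"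
    and s: "s \<in> metric_selections N (- pi) pi F"
    and \<delta>: "0 < \<delta>" "\<bar>x\<bar> + 2 * \<delta> \<le> pi" and n: "n \<ge> 1"
  shows "N ((1 / pi) *\<^sub>R integral {- pi..pi} (\<lambda>t. dirichlet_kernel n (x - t) *\<^sub>R s t)
      - (1 / 2) *\<^sub>R (Lim (at_right x) s + Lim (at_left x) s))
    \<le> C' * (real CARD('d) * (208 * C)) *
      (enn2real (variation N (- pi) pi F) / real n * (1 + 6 * cot (\<delta> / 2))
       + max (left_quasi_modulus (- pi) pi (variation_fun N (- pi) F) x (2 * \<delta>))
             (right_quasi_modulus (- pi) pi (variation_fun N (- pi) F) x \<delta>))"
    (is "N ?D \<le> C' * (real CARD('d) * (208 * C)) * ?R")
proof -
  interpret BV_multifunction N "- pi" pi F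
    using N F by unfold_locales auto
  define W where "W = (\<lambda>t. C * (v t + v_left t))"
  define \<omega> where "\<omega> = max (left_quasi_modulus (- pi) pi v x (2 * \<delta>)) (right_quasi_modulus (- pi) pi v x \<delta>)"
  have x: "- pi < x" "x < pi" using \<delta> by auto
  have ctrl: "\<bar>s t $ j - s u $ j\<bar> \<le> W u - W t" if "- pi \<le> t" "t \<le> u" "u \<le> pi" for t u j
  proof -
    have "\<bar>s t $ j - s u $ j\<bar> \<le> norm (s t - s u)"
      using component_le_norm_cart[of "s t - s u" j] by simp
    also have "\<dots> \<le> C * N (s t - s u)" by (rule C(2))
    also have "\<dots> \<le> C * ((v u + v_left u) - (v t + v_left t))"
      using metric_selection_control_sum[OF s that] C(1) by (intro mult_left_mono) auto
    finally show ?thesis by (simp add: W_def algebra_simps)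
  qed
  obtain vl vr where v_lim: "(v \<longlongrightarrow> vl) (at_left x)" "(v \<longlongrightarrow> vr) (at_right x)"
    and v_bounds: "\<And>t. - pi \<le> t \<Longrightarrow> t < x \<Longrightarrow> v t \<le> vl" "\<And>t. x < t \<Longrightarrow> t \<le> pi \<Longrightarrow> vr \<le> v t"
    using v_one_sided_limits[OF x] by blast
  have W_mono: "W t \<le> W u" if "- pi \<le> t" "t \<le> u" "u \<le> pi" for t u
    using ctrl[OF that, of undefined] by linarith
  obtain wl wr where W_lim: "(W \<longlongrightarrow> wl) (at_left x)" "(W \<longlongrightarrow> wr) (at_right x)"
    using mono_one_sided_limits[OF x, of W, OF W_mono] by blast
  have W_le: "W t \<le> C * (2 * v t)" if "t \<le> pi" for t
    unfolding W_def using v_left_le_v[OF that] C(1) by (intro mult_left_mono) auto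
  have W_ge: "C * (2 * r) \<le> W t" if "r \<le> v t" "r \<le> v_left t" for r t
    unfolding W_def using that C(1) by (intro mult_left_mono) auto
  have left_modulus: "vl - v (x - 2 * \<delta>) \<le> \<omega>"
    unfolding \<omega>_def using x \<delta>
    by (intro max.coboundedI1 left_quasi_modulus_ge[OF v_lim(1)]) auto
  have right_modulus: "v (x + \<delta>) - vr \<le> \<omega>"
    unfolding \<omega>_def using x \<delta>
    by (intro max.coboundedI2 right_quasi_modulus_ge[OF v_lim(2)]) auto
  have "wl \<le> C * (2 * vl)"
  proof (rule tendsto_le[OF trivial_limit_at_left_real])
    show "((\<lambda>t. C * (2 * v t)) \<longlongrightarrow> C * (2 * vl)) (at_left x)" by (intro tendsto_intros v_lim)
    show "eventually (\<lambda>t. W t \<le> C * (2 * v t)) (at_left x)"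
      using x W_le unfolding eventually_at_left_field by (intro exI[of _ "- pi"]) auto
  qed (rule W_lim)
  \<comment> \<open>\<open>v_left (x - \<delta>)\<close> may be smaller than
    \<open>v (x - \<delta>)\<close>, but not smaller than \<open>v\<close> at any earlier point; x -
    2 \<delta> is the point chosen.\<close>
  moreover have "C * (2 * v (x - 2 * \<delta>)) \<le> W (x - \<delta>)"
    using \<delta> by (intro W_ge v_mono v_le_v_left) auto
  ultimately have left: "wl - W (x - \<delta>) \<le> 2 * C * \<omega>"
    using mult_left_mono[OF left_modulus, of "2 * C"] C(1) by (simp add: algebra_simps)
  have "C * (2 * vr) \<le> wr"
  proof (rule tendsto_lowerbound[OF W_lim(2)])
    have "C * (2 * vr) \<le> W t" if t: "x < t" "t < pi" for t
    proof (rule W_ge)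
      \<comment> \<open>The midpoint lies strictly between \<open>x\<close> and \<open>t\<close>. On
        the right the left limit thus costs nothing, and \<delta> need not be doubled.\<close>
      have "vr \<le> v ((x + t) / 2)" using t by (intro v_bounds) auto
      also have "\<dots> \<le> v_left t" using t by (intro v_le_v_left) auto
      finally show "vr \<le> v_left t" .
    qed (use v_bounds t in auto)
    then show "eventually (\<lambda>t. C * (2 * vr) \<le> W t) (at_right x)"
      using x unfolding eventually_at_right_field by (intro exI[of _ pi]) auto
  qed simp
  moreover have "W (x + \<delta>) \<le> C * (2 * v (x + \<delta>))"
    using \<delta> by (intro W_le) auto
  ultimately have right: "W (x + \<delta>) - wr \<le> 2 * C * \<omega>"
    using mult_left_mono[OF right_modulus, of "2 * C"] C(1) by (simp add: algebra_simps)
  have "0 \<le> v_left (- pi)"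
    using v_le_v_left[of "- pi - 1" "- pi"] v_nonneg[of "- pi - 1"] by simp
  then have total: "W pi - W (- pi) \<le> 2 * C * v pi"
    using W_le[of pi] W_ge[of 0 "- pi"] v_nonneg[of "- pi"] by simp
  have cot0: "0 \<le> cot (\<delta> / 2)"
    using \<delta> unfolding cot_def by (intro divide_nonneg_nonneg cos_ge_zero sin_ge_zero) auto

  define I where "I = integral {- pi..pi} (\<lambda>t. dirichlet_kernel n (x - t) *\<^sub>R s t)"
  have "\<exists>l r. ((\<lambda>t. s t $ j) \<longlongrightarrow> l) (at_left x) \<and> ((\<lambda>t. s t $ j) \<longlongrightarrow> r) (at_right x)" for j
    using controlled_one_sided_limits[OF x, of "\<lambda>t. s t $ j" W, OF ctrl] by blast
  then obtain gl gr where g_lim: "\<And>j. ((\<lambda>t. s t $ j) \<longlongrightarrow> gl j) (at_left x)"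
    "\<And>j. ((\<lambda>t. s t $ j) \<longlongrightarrow> gr j) (at_right x)"
    by metis
  have "(s \<longlongrightarrow> (\<chi> j. gl j)) (at_left x)" "(s \<longlongrightarrow> (\<chi> j. gr j)) (at_right x)"
    by (intro vec_tendstoI; simp add: g_lim)+
  then have Lims: "Lim (at_left x) s = (\<chi> j. gl j)" "Lim (at_right x) s = (\<chi> j. gr j)"
    by (auto intro!: tendsto_Lim)
  have comp: "\<bar>?D $ j\<bar> \<le> 208 * C * (v pi / real n * (1 + 6 * cot (\<delta> / 2)) + \<omega>)" for j
  proof -
    define E where "E = I $ j - pi / 2 * (gl j + gr j)"
    have "I $ j = integral {- pi..pi} (\<lambda>t. dirichlet_kernel n (x - t) * s t $ j)"
      unfolding I_def
      using integral_component_eq_cart[OF weighted_selection_integrable[OF continuous_on_dirichlet_kernel s], of n x j]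
      by simp
    then have "\<bar>E\<bar> \<le> 52 * ((wl - W (x - \<delta>)) + (W (x + \<delta>) - wr))
       + 4 * (W pi - W (- pi)) * ((1 + 2 * cot (\<delta> / 2)) / real n)"
      unfolding E_def
      using fourier_integral_jump_bound[OF \<delta>(1) _ n ctrl g_lim(1) W_lim(1) g_lim(2) W_lim(2)] \<delta>
      by simp
    \<comment> \<open>Nonnegativity of the cotangent allows 2 to be raised to the factor 6 of the
      claim.\<close>
    also have "\<dots> \<le> 52 * (2 * C * \<omega> + 2 * C * \<omega>) + 4 * (2 * C * v pi) * ((1 + 6 * cot (\<delta> / 2)) / real n)"
      using left right total cot0 v_nonneg C(1) n
      by (intro add_mono mult_mono divide_right_mono mult_left_mono) auto
    also have "\<dots> \<le> 208 * C * (v pi / real n * (1 + 6 * cot (\<delta> / 2)) + \<omega>)"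
    proof -
      define Z where "Z = C * (v pi / real n * (1 + 6 * cot (\<delta> / 2)))"
      have "0 \<le> Z"
        unfolding Z_def using cot0 v_nonneg C(1) by (intro mult_nonneg_nonneg divide_nonneg_nonneg) auto
      moreover have "4 * (2 * C * v pi) * ((1 + 6 * cot (\<delta> / 2)) / real n) = 8 * Z"
        by (simp add: Z_def)
      moreover have "208 * C * (v pi / real n * (1 + 6 * cot (\<delta> / 2)) + \<omega>) = 208 * Z + 208 * C * \<omega>"
        by (simp add: Z_def distrib_left)
      ultimately show ?thesis by simp
    qed
    finally have E: "\<bar>E\<bar> \<le> 208 * C * (v pi / real n * (1 + 6 * cot (\<delta> / 2)) + \<omega>)" .
    have "?D $ j = (1 / pi) * E"
      by (simp add: I_def[symmetric] Lims E_def field_simps)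
    then have "\<bar>?D $ j\<bar> = (1 / pi) * \<bar>E\<bar>"
      by (simp add: abs_mult)
    also have "\<dots> \<le> 1 * \<bar>E\<bar>"
      using pi_gt3 by (intro mult_right_mono) auto
    finally have "\<bar>?D $ j\<bar> \<le> \<bar>E\<bar>" by simp
    with E show ?thesis by linarith
  qed
  have "N ?D \<le> C' * (\<Sum>j\<in>UNIV. \<bar>?D $ j\<bar>)" by (rule C'(2))
  also have "\<dots> \<le> C' * (\<Sum>j\<in>(UNIV :: 'd set). 208 * C * (v pi / real n * (1 + 6 * cot (\<delta> / 2)) + \<omega>))"
    using C'(1) comp by (intro mult_left_mono sum_mono) auto
  also have "\<dots> = C' * (real CARD('d) * (208 * C)) * ?R"
    by (simp add: \<omega>_def variation_fun_def)
  finally show ?thesis .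
qed

theorem proposition6p17:
  fixes N :: "real ^ 'd \<Rightarrow> real"
  assumes "is_norm N"
  shows "\<exists>K>0. \<forall>x\<in>{- pi<..<pi}. \<exists>\<delta>\<^sub>0>0. \<forall>F\<in>BV_compact_graph N (- pi) pi.
    \<forall>\<delta>\<in>{0<..\<delta>\<^sub>0}. \<forall>n\<ge>1.
      haus N (metric_fourier N n F x) (limit_set N F x)
        \<le> ennreal (K * (enn2real (variation N (- pi) pi F) / real n * (1 + 6 * cot (\<delta> / 2))
            + max (left_quasi_modulus (- pi) pi (variation_fun N (- pi) F) x (2 * \<delta>))
                  (right_quasi_modulus (- pi) pi (variation_fun N (- pi) F) x \<delta>)))"
proof -
  obtain C where C: "C > 0" "\<And>z. norm z \<le> C * N z"
    using is_norm_dominates_norm[OF assms] by blast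
  obtain C' where C': "C' > 0" "\<And>z. N z \<le> C' * (\<Sum>j\<in>UNIV. \<bar>z $ j\<bar>)"
    using is_norm_le_sum_components[OF assms] by blast
  define K where "K = C' * (real CARD('d) * (208 * C))"
  show ?thesis
  proof (rule exI[of _ K], intro conjI ballI)
    show "K > 0" using C(1) C'(1) by (simp add: K_def)
    fix x assume x: "x \<in> {- pi<..<pi}"
    show "\<exists>\<delta>\<^sub>0>0. \<forall>F\<in>BV_compact_graph N (- pi) pi. \<forall>\<delta>\<in>{0<..\<delta>\<^sub>0}. \<forall>n\<ge>1.
      haus N (metric_fourier N n F x) (limit_set N F x)
        \<le> ennreal (K * (enn2real (variation N (- pi) pi F) / real n * (1 + 6 * cot (\<delta> / 2))
            + max (left_quasi_modulus (- pi) pi (variation_fun N (- pi) F) x (2 * \<delta>))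
                  (right_quasi_modulus (- pi) pi (variation_fun N (- pi) F) x \<delta>)))"
    \<comment> \<open>This choice keeps x - 2 \<delta> and x + \<delta> inside the interval from -pi
      to pi. It depends on \<open>x\<close> only, so it can precede the choice of
      \<open>F\<close>.\<close>
    proof (rule exI[of _ "(pi - \<bar>x\<bar>) / 2"], intro conjI ballI allI impI)
      show "(pi - \<bar>x\<bar>) / 2 > 0" using x by auto
      fix F \<delta> and n :: nat
      assume F: "F \<in> BV_compact_graph N (- pi) pi" and \<delta>: "\<delta> \<in> {0<..(pi - \<bar>x\<bar>) / 2}" and n: "1 \<le> n"
      interpret BV_multifunction N "- pi" pi F
        using assms F by unfold_locales auto
      have "metric_fourier N n F x = (\<lambda>s. (1 / pi) *\<^sub>R integral {- pi..pi} (\<lambda>t. dirichlet_kernel n (x - t) *\<^sub>R s t))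
          ` metric_selections N (- pi) pi F"
        unfolding metric_fourier_def weighted_metric_integral_eq[OF continuous_on_dirichlet_kernel] image_image ..
      moreover have "limit_set N F x = (\<lambda>s. (1 / 2) *\<^sub>R (Lim (at_right x) s + Lim (at_left x) s))
          ` metric_selections N (- pi) pi F"
        unfolding limit_set_def by blast
      ultimately show "haus N (metric_fourier N n F x) (limit_set N F x)
        \<le> ennreal (K * (enn2real (variation N (- pi) pi F) / real n * (1 + 6 * cot (\<delta> / 2))
            + max (left_quasi_modulus (- pi) pi (variation_fun N (- pi) F) x (2 * \<delta>))
                  (right_quasi_modulus (- pi) pi (variation_fun N (- pi) F) x \<delta>)))"
        unfolding K_def using \<delta> n
        by (simp only:) (intro haus_image_le selection_fourier_bound[OF assms F C C'] is_normD(7)[OF assms]; simp)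
    qed
  qed
qed

end
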